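(* Let $n\geq 2$ and let $\Omega\subset\mathbb{R}^n$ be a convex body with nonempty interior and width $\omega$. Then for every $t\geq 0$ the inner parallel set $\Omega_t$ satisfies $$|\partial\Omega_t|\geq\Bigl(1-\frac{2\sqrt{n}}{\omega}\,t\Bigr)_+^{n-1}|\partial\Omega|\quad\text{if } n \text{ is odd},$$ $$|\partial\Omega_t|\geq\Bigl(1-\frac{2(n+1)}{\omega\sqrt{n+2}}\,t\Bigr)_+^{n-1}|\partial\Omega|\quad\text{if } n \text{ is even}.$$ In both cases equality holds if $\Omega$ is a regular simplex in $\mathbb{R}^n$ (with $n+1$ vertices).
   Context: A convex body is a compact convex subset of $\mathbb{R}^n$. Let $B$ be the closed unit ball and $\mathbb{S}^{n-1}$ the unit sphere of $\mathbb{R}^n$. For $t\geq 0$ the inner parallel set of $\Omega$ at distance $t$ is $\Omega_t=\{x\in\Omega:\operatorname{dist}(x,\Omega^c)\geq t\}=\{x\in\mathbb{R}^n: x+tB\subseteq\Omega\}$ (it may be empty). For a convex body $K$, $|\partial K|$ denotes its perimeter, i.e. the surface area ($(n-1)$-dimensional Hausdorff measure) of its boundary, with $|\partial\emptyset|=0$. With the support function $h(\Omega,u)=\sup_{x\in\Omega}\langle x,u\rangle$, the width of $\Omega$ is $\omega=\inf\{h(\Omega,u)+h(\Omega,-u):u\in\mathbb{S}^{n-1}\}$. For real $x$, $x_+=(|x|+x)/2=\max\{x,0\}$, and $(x)_+^{n-1}$ means $(x_+)^{n-1}$. *)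

theory Defs
  imports "HOL-Analysis.Analysis"
begin

text \<open>
  The \<open>k\<close>-dimensional Hausdorff measure, as an outer measure on all sets, with the usual
  normalisation: \<open>unit_ball_vol k / 2 ^ k\<close> times the sum of the \<open>k\<close>-th powers of the diameters.
  The empty set gets weight 0 also for \<open>k = 0\<close>, so that dimension 0 gives the counting measure.
  Boundedness of the covering sets is required explicitly because \<^const>\<open>diameter\<close> is
  meaningless for unbounded sets.
\<close>

definition hausdorff_weight :: "nat \<Rightarrow> 'a::metric_space set \<Rightarrow> ennreal" where
  "hausdorff_weight k C =
     (if C = {} then 0 else ennreal (unit_ball_vol (real k) * (diameter C / 2) ^ k))"

definition hausdorff_premeasure :: "nat \<Rightarrow> real \<Rightarrow> 'a::metric_space set \<Rightarrow> ennreal" where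
  "hausdorff_premeasure k \<delta> A =
     (INF C \<in> {C :: nat \<Rightarrow> 'a set. A \<subseteq> (\<Union>i. C i) \<and> (\<forall>i. bounded (C i) \<and> diameter (C i) \<le> \<delta>)}.
        \<Sum>i. hausdorff_weight k (C i))"

definition hausdorff_measure :: "nat \<Rightarrow> 'a::metric_space set \<Rightarrow> ennreal" where
  "hausdorff_measure k A = (SUP \<delta> \<in> {0<..}. hausdorff_premeasure k \<delta> A)"

definition perimeter :: "'a::euclidean_space set \<Rightarrow> ennreal" where
  "perimeter K = hausdorff_measure (DIM('a) - 1) (frontier K)"

definition support_function :: "'a::euclidean_space set \<Rightarrow> 'a \<Rightarrow> real" where
  "support_function S u = (SUP x\<in>S. x \<bullet> u)"

definition width :: "'a::euclidean_space set \<Rightarrow> real" where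
  "width S = (INF u\<in>sphere 0 1. support_function S u + support_function S (- u))"

definition inner_parallel :: "'a::euclidean_space set \<Rightarrow> real \<Rightarrow> 'a set" where
  "inner_parallel S t = {x \<in> S. t \<le> infdist x (- S)}"

text \<open>
  The hypothesis \<open>S \<noteq> UNIV\<close>, automatic for compact \<open>S\<close>, is needed because
  \<^const>\<open>infdist\<close> to the empty set is 0.
\<close>

lemma inner_parallel_eq_cball:
  fixes S :: "'a::euclidean_space set"
  assumes "closed S" "S \<noteq> UNIV" "0 \<le> t"
  shows "inner_parallel S t = {x. cball x t \<subseteq> S}"
proof (intro set_eqI iffI)
  fix x assume "x \<in> inner_parallel S t"
  then have x: "x \<in> S" "t \<le> infdist x (- S)"
    by (auto simp: inner_parallel_def)
  have "y \<in> S" if y: "dist x y < t" for y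
    using infdist_le[of y "- S" x] x y by force
  then have sub: "ball x t \<subseteq> S"
    by auto
  have "cball x t \<subseteq> S"
  proof (cases "t = 0")
    case True
    then show ?thesis using x by simp
  next
    case False
    then show ?thesis
      using closure_minimal[OF sub \<open>closed S\<close>] \<open>0 \<le> t\<close> by simp
  qed
  then show "x \<in> {x. cball x t \<subseteq> S}" by simp
next
  fix x assume "x \<in> {x. cball x t \<subseteq> S}"
  then have sub: "cball x t \<subseteq> S" by simp
  have "t \<le> dist x y" if "y \<in> - S" for y
    using sub that by force
  moreover have "- S \<noteq> {}" using \<open>S \<noteq> UNIV\<close> by blast
  ultimately have "t \<le> infdist x (- S)"
    by (auto simp: infdist_def intro!: cINF_greatest)
  moreover have "x \<in> S" using sub \<open>0 \<le> t\<close> by force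
  ultimately show "x \<in> inner_parallel S t"
    by (simp add: inner_parallel_def)
qed

definition regular_simplex :: "'a::euclidean_space set \<Rightarrow> bool" where
  "regular_simplex S \<longleftrightarrow>
     (\<exists>V d. card V = DIM('a) + 1 \<and> \<not> affine_dependent V \<and>
        (\<forall>x\<in>V. \<forall>y\<in>V. x \<noteq> y \<longrightarrow> dist x y = d) \<and> S = convex hull V)"

end

theory Submission
  imports Defs
begin

text \<open>
  The proof has two independent halves, joined by the inradius of \<open>\<Omega>\<close>.

  First, let \<open>\<Omega>\<close> contain the ball of radius \<open>r\<close> about \<open>x\<close>. By convexity the copy of \<open>\<Omega>\<close> shrunk
  towards \<open>x\<close> by the factor \<open>1 - t / r\<close> keeps at least the distance \<open>t\<close> from the complement, so it lies in
  the inner parallel set. For convex bodies the perimeter is monotone under inclusion, because the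
  nearest-point projection onto the smaller body is 1-Lipschitz and maps the boundary of the larger
  body onto the boundary of the smaller one. Together with the scaling of Hausdorff measure this gives
  \<open>perimeter \<Omega>\<^sub>t \<ge> (1 - t / r)\<^sub>+ ^ (n - 1) * perimeter \<Omega>\<close>
  (lemma \<open>perimeter_inner_parallel_ge\<close>).

  Second, Steinhagen's inequality bounds the width by a constant \<open>steinhagen n\<close> times the inradius,
  and this constant divided by the width is exactly the coefficient of \<open>t\<close> in the theorem. At a largest
  inscribed ball, \<open>0\<close> is a convex combination \<open>\<Sum>\<lambda>\<^sub>i u\<^sub>i\<close> of the outer unit normals at no more than
  \<open>n + 1\<close> contact points. For any set \<open>I\<close> of indices put \<open>v = (\<Sum>i\<in>I. \<lambda>\<^sub>i u\<^sub>i)\<close>; then \<open>- v\<close> is the sum over the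
  complementary indices, so the supporting half-spaces bound the extent of \<open>\<Omega>\<close> in direction \<open>v\<close>, and
  they give \<open>width \<Omega> * norm v \<le> r * (\<Sum>\<lambda>\<^sub>i) = r\<close>. Averaging \<open>(norm v)\<^sup>2\<close> over all \<open>I\<close> of size
  \<open>(n + 1) div 2\<close> shows that some choice makes \<open>norm v\<close> at least \<open>1 / steinhagen n\<close>
  (lemmas \<open>ex_large_subset_sum\<close> and \<open>steinhagen_inequality\<close>). The parity of \<open>n\<close> enters only through
  this halving of \<open>n + 1\<close> points.

  For a regular simplex both steps are sharp. Its inner parallel sets are contained in the homothetic
  copies about the centroid, since all facets have the same distance from it, and the opposite
  inequality \<open>width \<ge> steinhagen n * inradius\<close> holds: the projections of the vertices to a line have
  mean \<open>0\<close> and, since the vertices form a tight frame, a sum of squares that is independent of the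
  line. Numbers with a prescribed sum of squares about their mean must spread over a range of a certain
  length (\<open>sum_squares_le_range\<close>), and the length is least when, as nearly as parity
  permits, half of them sit at either end.
\<close>

section \<open>Hausdorff measure and the perimeter of convex bodies\<close>

text \<open>
  The images of a cover of \<open>A\<close>, intersected with \<open>A\<close>, cover \<open>B\<close>, and their diameters grow at most
  by the factor \<open>c\<close>.
\<close>

lemma hausdorff_premeasure_lipschitz_le:
  fixes f :: "'a::metric_space \<Rightarrow> 'b::metric_space"
  assumes f: "c-lipschitz_on A f" and "c > 0" and B: "B \<subseteq> f ` A"
  shows "hausdorff_premeasure k (c * \<delta>) B \<le> ennreal (c ^ k) * hausdorff_premeasure k \<delta> A"
proof -
  let ?F = "\<lambda>A \<delta> (C :: nat \<Rightarrow> _ set). A \<subseteq> (\<Union>i. C i) \<and> (\<forall>i. bounded (C i) \<and> diameter (C i) \<le> \<delta>)"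
  have "hausdorff_premeasure k (c * \<delta>) B \<le> ennreal (c ^ k) * (\<Sum>i. hausdorff_weight k (C i))"
    if C: "?F A \<delta> C" for C
  proof -
    define D where "D i = f ` (C i \<inter> A)" for i
    have bound: "dist x y \<le> c * diameter (C i)" if xy: "x \<in> D i" "y \<in> D i" for x y i
    proof -
      obtain a b where ab: "x = f a" "y = f b" "a \<in> C i" "b \<in> C i" "a \<in> A" "b \<in> A"
        using xy unfolding D_def by blast
      have "dist x y \<le> c * dist a b"
        using lipschitz_onD[OF f] ab by simp
      also have "\<dots> \<le> c * diameter (C i)"
        using diameter_bounded_bound[of "C i" a b] C ab \<open>c > 0\<close> by simp
      finally show ?thesis .
    qed
    have bdd: "bounded (D i)" for i
    proof (cases "D i = {}")
      case False
      then obtain x where "x \<in> D i" by auto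
      then show ?thesis using bound[of x i] by (auto simp: bounded_def)
    qed simp
    have diam: "diameter (D i) \<le> c * diameter (C i)" for i
    proof (cases "D i = {}")
      case True
      then show ?thesis using \<open>c > 0\<close> diameter_ge_0[of "C i"] C by simp
    next
      case False
      then show ?thesis
        unfolding diameter_def[of "D i"] using bound by (auto intro!: cSUP_least)
    qed
    have weight: "hausdorff_weight k (D i) \<le> ennreal (c ^ k) * hausdorff_weight k (C i)" for i
    proof (cases "D i = {}")
      case False
      then have ne: "C i \<noteq> {}" by (auto simp: D_def)
      have "(diameter (D i) / 2) ^ k \<le> (c * diameter (C i) / 2) ^ k"
        using diam[of i] diameter_ge_0[OF bdd[of i]] by (intro power_mono) auto
      also have "\<dots> = c ^ k * (diameter (C i) / 2) ^ k"
        by (simp only: times_divide_eq_right[symmetric] power_mult_distrib)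
      finally have "unit_ball_vol (real k) * (diameter (D i) / 2) ^ k
          \<le> unit_ball_vol (real k) * (c ^ k * (diameter (C i) / 2) ^ k)"
        by (intro mult_left_mono) auto
      then have "unit_ball_vol (real k) * (diameter (D i) / 2) ^ k
          \<le> c ^ k * (unit_ball_vol (real k) * (diameter (C i) / 2) ^ k)"
        by (simp only: mult.left_commute)
      then show ?thesis
        using False ne \<open>c > 0\<close> by (simp add: hausdorff_weight_def ennreal_leI flip: ennreal_mult')
    qed (simp add: hausdorff_weight_def)
    have "?F B (c * \<delta>) D"
    proof (intro conjI allI)
      show "B \<subseteq> (\<Union>i. D i)" using B C by (fastforce simp: D_def)
      show "diameter (D i) \<le> c * \<delta>" for i
        using diam[of i] C \<open>c > 0\<close> by (meson mult_le_cancel_left_pos order_trans)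
    qed (fact bdd)
    then have "hausdorff_premeasure k (c * \<delta>) B \<le> (\<Sum>i. hausdorff_weight k (D i))"
      unfolding hausdorff_premeasure_def by (intro INF_lower) simp
    also have "\<dots> \<le> (\<Sum>i. ennreal (c ^ k) * hausdorff_weight k (C i))"
      by (intro suminf_le weight) auto
    finally show ?thesis by simp
  qed
  note * = this
  have inv: "ennreal (1 / c ^ k) * (ennreal (c ^ k) * z) = z"
    "ennreal (c ^ k) * (ennreal (1 / c ^ k) * z) = z" for z
    using \<open>c > 0\<close> by (simp_all flip: mult.assoc ennreal_mult')
  \<comment> \<open>Dividing by \<open>c ^ k\<close> moves the factor out of the way of the infimum over covers, which may be
    an infimum over the empty set.\<close>
  have "ennreal (1 / c ^ k) * hausdorff_premeasure k (c * \<delta>) B \<le> hausdorff_premeasure k \<delta> A"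
    unfolding hausdorff_premeasure_def[of k \<delta> A]
  proof (rule INF_greatest)
    fix C :: "nat \<Rightarrow> 'a set" assume "C \<in> {C. ?F A \<delta> C}"
    then have "ennreal (1 / c ^ k) * hausdorff_premeasure k (c * \<delta>) B
        \<le> ennreal (1 / c ^ k) * (ennreal (c ^ k) * (\<Sum>i. hausdorff_weight k (C i)))"
      by (intro mult_left_mono *) auto
    then show "ennreal (1 / c ^ k) * hausdorff_premeasure k (c * \<delta>) B \<le> (\<Sum>i. hausdorff_weight k (C i))"
      by (simp only: inv)
  qed
  then have "ennreal (c ^ k) * (ennreal (1 / c ^ k) * hausdorff_premeasure k (c * \<delta>) B)
      \<le> ennreal (c ^ k) * hausdorff_premeasure k \<delta> A"
    by (intro mult_left_mono) auto
  then show ?thesis by (simp only: inv)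
qed

lemma hausdorff_measure_lipschitz_le:
  fixes f :: "'a::metric_space \<Rightarrow> 'b::metric_space"
  assumes f: "c-lipschitz_on A f" and "c > 0" and B: "B \<subseteq> f ` A"
  shows "hausdorff_measure k B \<le> ennreal (c ^ k) * hausdorff_measure k A"
  unfolding hausdorff_measure_def[of k B]
proof (rule SUP_least)
  fix \<delta> :: real assume \<delta>: "\<delta> \<in> {0<..}"
  have "hausdorff_premeasure k (c * (\<delta> / c)) B \<le> ennreal (c ^ k) * hausdorff_premeasure k (\<delta> / c) A"
    by (rule hausdorff_premeasure_lipschitz_le[OF assms])
  also have "\<dots> \<le> ennreal (c ^ k) * hausdorff_measure k A"
    unfolding hausdorff_measure_def using \<delta> \<open>c > 0\<close>
    by (intro mult_left_mono SUP_upper) auto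
  finally show "hausdorff_premeasure k \<delta> B \<le> ennreal (c ^ k) * hausdorff_measure k A"
    using \<open>c > 0\<close> by simp
qed

lemma hausdorff_measure_singleton:
  assumes "k > 0"
  shows "hausdorff_measure k {x} = 0"
proof -
  have "hausdorff_premeasure k \<delta> {x} \<le> (\<Sum>i::nat. hausdorff_weight k {x})" if "\<delta> > 0" for \<delta>
    unfolding hausdorff_premeasure_def using that by (intro INF_lower) auto
  moreover have "hausdorff_weight k {x} = 0"
    using assms by (simp add: hausdorff_weight_def)
  ultimately have "hausdorff_premeasure k \<delta> {x} = 0" if "\<delta> > 0" for \<delta>
    using that by auto
  then show ?thesis
    by (auto simp: hausdorff_measure_def intro!: antisym SUP_least)
qed

text \<open>
  A body without interior has to be treated apart: its whole frontier is the body itself, and the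
  normal of a hyperplane containing it serves at every point.
\<close>

lemma frontier_supporting_normal:
  fixes K :: "'a::euclidean_space set"
  assumes "convex K" "closed K" "x \<in> frontier K"
  obtains a where "a \<noteq> 0" "\<And>y. y \<in> K \<Longrightarrow> y \<bullet> a \<le> x \<bullet> a"
proof (cases "interior K = {}")
  case True
  then obtain a b where "a \<noteq> 0" "K \<subseteq> {y. a \<bullet> y = b}"
    using empty_interior_subset_hyperplane[OF \<open>convex K\<close>] by blast
  moreover have "x \<in> K" using assms frontier_subset_closed by blast
  ultimately show thesis
    by (intro that[of a]) (auto simp: inner_commute subset_iff)
next
  case False
  then have x: "x \<in> closure K" "x \<notin> rel_interior K"
    using assms by (auto simp: frontier_def rel_interior_nonempty_interior)
  show thesis
  proof (rule supporting_hyperplane_relative_frontier[OF \<open>convex K\<close> x])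
    fix a assume a: "a \<noteq> 0" "\<And>y. y \<in> closure K \<Longrightarrow> a \<bullet> x \<le> a \<bullet> y"
    show thesis
    proof (rule that[of "- a"])
      show "y \<bullet> - a \<le> x \<bullet> - a" if "y \<in> K" for y
        using a(2)[OF subsetD[OF closure_subset that]] by (simp add: inner_commute)
    qed (use a(1) in simp)
  qed
qed

text \<open>
  The ray that leaves \<open>K\<close> from a boundary point \<open>x\<close> in the direction of an outer normal is projected
  back to \<open>x\<close> by the nearest-point map, and it meets the boundary of the bounded set \<open>L\<close>. Hence the
  nearest-point map takes \<open>frontier L\<close> onto a superset of \<open>frontier K\<close>.
\<close>

lemma perimeter_mono:
  fixes K L :: "'a::euclidean_space set"
  assumes K: "convex K" "closed K" and L: "bounded L" and "K \<subseteq> L"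
  shows "perimeter K \<le> perimeter L"
proof (cases "K = {}")
  case True
  then show ?thesis
    using hausdorff_measure_lipschitz_le[of 1 "frontier L" id "{}" "DIM('a) - 1"]
    by (simp add: perimeter_def lipschitz_on_def)
next
  case False
  have "frontier K \<subseteq> closest_point K ` frontier L"
  proof
    fix x assume x: "x \<in> frontier K"
    then have "x \<in> K" using K frontier_subset_closed by blast
    obtain a where a: "a \<noteq> 0" "\<And>y. y \<in> K \<Longrightarrow> y \<bullet> a \<le> x \<bullet> a"
      using frontier_supporting_normal[OF K x] by blast
    obtain d where d: "d \<ge> 0" "x + d *\<^sub>R a \<in> frontier L"
    proof (cases "x \<in> interior L")
      case True
      then show thesis using ray_to_frontier[OF L True \<open>a \<noteq> 0\<close>] that by (metis less_imp_le)
    next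
      case False
      then have "x \<in> frontier L"
        using \<open>x \<in> K\<close> \<open>K \<subseteq> L\<close> closure_subset by (auto simp: frontier_def)
      then show thesis using that[of 0] by simp
    qed
    have "dist (x + d *\<^sub>R a) x \<le> dist (x + d *\<^sub>R a) y" if "y \<in> K" for y
    proof -
      have "(norm (x + d *\<^sub>R a - y))\<^sup>2 = (norm (x - y))\<^sup>2 + (norm (d *\<^sub>R a))\<^sup>2 + 2 * d * (x \<bullet> a - y \<bullet> a)"
        by (simp only: power2_norm_eq_inner) (simp add: algebra_simps inner_commute)
      moreover have "0 \<le> 2 * d * (x \<bullet> a - y \<bullet> a)"
        using d a(2)[OF that] by simp
      ultimately have "(norm (d *\<^sub>R a))\<^sup>2 \<le> (norm (x + d *\<^sub>R a - y))\<^sup>2"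
        using zero_le_power2[of "norm (x - y)"] by linarith
      then have "norm (d *\<^sub>R a) \<le> norm (x + d *\<^sub>R a - y)"
        by (rule power2_le_imp_le) simp
      then show ?thesis by (simp add: dist_norm)
    qed
    then have "closest_point K (x + d *\<^sub>R a) = x"
      using closest_point_unique[OF K \<open>x \<in> K\<close>] by metis
    then show "x \<in> closest_point K ` frontier L" using d by force
  qed
  moreover have "1-lipschitz_on (frontier L) (closest_point K)"
    using closest_point_lipschitz[OF K False] by (auto intro!: lipschitz_onI)
  ultimately show ?thesis
    using hausdorff_measure_lipschitz_le[of 1 "frontier L" "closest_point K" "frontier K" "DIM('a) - 1"]
    by (simp add: perimeter_def)
qed

definition homothety :: "'a::real_vector \<Rightarrow> real \<Rightarrow> 'a \<Rightarrow> 'a" where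
  "homothety c s x = c + s *\<^sub>R (x - c)"

lemma homothety_inverse:
  assumes "s \<noteq> 0"
  shows "homothety c (1 / s) (homothety c s x) = x"
  using assms by (simp add: homothety_def)

lemma frontier_homothety:
  fixes K :: "'a::euclidean_space set"
  assumes "s \<noteq> 0"
  shows "frontier (homothety c s ` K) = homothety c s ` frontier K"
proof -
  have *: "homothety c s ` K = (+) (c - s *\<^sub>R c) ` ((*\<^sub>R) s ` K)" for K
    by (auto simp: homothety_def image_image algebra_simps)
  have "frontier ((*\<^sub>R) s ` K) = (*\<^sub>R) s ` frontier K"
    using assms
    by (simp add: frontier_def closure_scaleR[symmetric]
        interior_injective_linear_image injective_scaleR image_set_diff)
  then show ?thesis
    by (simp add: * frontier_translation)
qed

lemma perimeter_homothety_le: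
  fixes K :: "'a::euclidean_space set"
  assumes "s > 0"
  shows "perimeter (homothety c s ` K) \<le> ennreal (s ^ (DIM('a) - 1)) * perimeter K"
  unfolding perimeter_def
proof (rule hausdorff_measure_lipschitz_le)
  show "s-lipschitz_on (frontier K) (homothety c s)"
    using assms by (intro lipschitz_onI) (auto simp: homothety_def dist_norm simp flip: scaleR_diff_right)
  show "frontier (homothety c s ` K) \<subseteq> homothety c s ` frontier K"
    using assms by (simp add: frontier_homothety)
qed fact

text \<open>
  The lower bound is the upper bound for the inverse homothety.
\<close>

lemma perimeter_homothety:
  fixes K :: "'a::euclidean_space set"
  assumes "s > 0"
  shows "perimeter (homothety c s ` K) = ennreal (s ^ (DIM('a) - 1)) * perimeter K"
proof (rule antisym)
  let ?n = "DIM('a) - 1"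
  have "homothety c (1 / s) ` homothety c s ` K = K"
    using assms by (simp add: image_image homothety_inverse)
  then have "perimeter K \<le> ennreal ((1 / s) ^ ?n) * perimeter (homothety c s ` K)"
    using perimeter_homothety_le[of "1 / s" c "homothety c s ` K"] assms by simp
  then have "ennreal (s ^ ?n) * perimeter K
      \<le> ennreal (s ^ ?n) * (ennreal ((1 / s) ^ ?n) * perimeter (homothety c s ` K))"
    by (intro mult_left_mono) auto
  also have "\<dots> = ennreal (s ^ ?n * (1 / s) ^ ?n) * perimeter (homothety c s ` K)"
    using assms by (simp add: ennreal_mult' mult.assoc)
  also have "s ^ ?n * (1 / s) ^ ?n = 1"
    using assms by (simp flip: power_mult_distrib)
  finally show "ennreal (s ^ ?n) * perimeter K \<le> perimeter (homothety c s ` K)" by simp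
qed (fact perimeter_homothety_le[OF assms])

section \<open>Large partial sums of vectors with sum zero\<close>

lemma card_subsets_separating:
  assumes "finite A" "i \<in> A" "j \<in> A" "i \<noteq> j" "k > 0"
  shows "card {I. I \<subseteq> A \<and> card I = k \<and> i \<in> I \<and> j \<notin> I} = (card A - 2) choose (k - 1)"
proof -
  have "{I. I \<subseteq> A \<and> card I = k \<and> i \<in> I \<and> j \<notin> I}
      = insert i ` {J. J \<subseteq> A - {i, j} \<and> card J = k - 1}" (is "?L = ?R")
  proof (intro equalityI subsetI)
    fix I assume "I \<in> ?L"
    then have "I - {i} \<in> {J. J \<subseteq> A - {i, j} \<and> card J = k - 1}" "I = insert i (I - {i})"
      by auto
    then show "I \<in> ?R" by blast
  next
    fix I assume "I \<in> ?R"
    then obtain J where J: "J \<subseteq> A - {i, j}" "card J = k - 1" "I = insert i J" by auto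
    moreover have "finite J" "i \<notin> J"
      using J(1) \<open>finite A\<close> by (auto intro: finite_subset)
    ultimately show "I \<in> ?L" using assms by auto
  qed
  moreover have "inj_on (insert i) {J. J \<subseteq> A - {i, j} \<and> card J = k - 1}"
    by (rule inj_onI) (auto dest: insert_ident[THEN iffD1, rotated 2])
  moreover have "card (A - {i, j}) = card A - 2"
    using assms by (simp add: card_Diff_subset)
  ultimately show ?thesis
    using assms by (simp add: card_image n_subsets)
qed

text \<open>
  The ratio of the two counts: a random \<open>k\<close>-subset of \<open>N\<close> points separates a given ordered pair with
  probability \<open>k * (N - k) / (N * (N - 1))\<close>.
\<close>

lemma binomial_separating:
  assumes "0 < k" "k < N"
  shows "N * (N - 1) * ((N - 2) choose (k - 1)) = k * (N - k) * (N choose k)"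
proof -
  obtain j where k: "k = Suc j" using assms gr0_implies_Suc by blast
  have "k * (N - k) * (N choose k) = (N - k) * (Suc j * (N choose Suc j))"
    by (simp only: k mult_ac)
  also have "\<dots> = N * (((N - 1) - j) * ((N - 1) choose j))"
    by (simp only: binomial_absorption) (simp add: k)
  also have "\<dots> = N * ((N - 1) * ((N - 1 - 1) choose j))"
    by (simp only: binomial_absorb_comp)
  finally show ?thesis by (simp add: k numeral_2_eq_2)
qed

text \<open>
  Since the complementary sum is \<open>- sum w I\<close>, the square of the norm is minus the inner product of the
  two sums. Only pairs separated by \<open>I\<close> occur, so summation over all \<open>I\<close> of a given size needs only the
  number of those that separate a given pair.
\<close>

lemma norm_subset_sum_eq:
  fixes w :: "'i \<Rightarrow> 'a::real_inner"
  assumes "finite A" "I \<subseteq> A" "sum w A = 0"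
  shows "(norm (sum w I))\<^sup>2 = (\<Sum>i\<in>A. \<Sum>j\<in>A. (if i \<in> I \<and> j \<notin> I then - (w i \<bullet> w j) else 0))"
proof -
  have "sum w I + sum w (A - I) = 0"
    using sum.subset_diff[OF assms(2,1), of w] assms(3) by (simp add: add.commute)
  then have "sum w I = - sum w (A - I)"
    by (simp add: eq_neg_iff_add_eq_0)
  then have "(norm (sum w I))\<^sup>2 = sum w I \<bullet> - sum w (A - I)"
    by (metis power2_norm_eq_inner)
  also have "\<dots> = (\<Sum>i\<in>I. \<Sum>j\<in>A - I. - (w i \<bullet> w j))"
    by (simp add: inner_sum_left inner_sum_right sum_negf sum.swap[of _ I])
  also have "\<dots> = (\<Sum>i\<in>I. \<Sum>j\<in>A. if j \<notin> I then - (w i \<bullet> w j) else 0)"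
    using assms by (intro sum.cong refl sum.mono_neutral_cong_left) auto
  also have "\<dots> = (\<Sum>i\<in>A. \<Sum>j\<in>A. (if i \<in> I \<and> j \<notin> I then - (w i \<bullet> w j) else 0))"
    using assms by (intro sum.mono_neutral_cong_left) auto
  finally show ?thesis .
qed

lemma sum_norm_subset_sums:
  fixes w :: "'i \<Rightarrow> 'a::real_inner"
  assumes A: "finite A" and w: "sum w A = 0" and "k > 0"
  shows "(\<Sum>I | I \<subseteq> A \<and> card I = k. (norm (sum w I))\<^sup>2)
    = ((card A - 2) choose (k - 1)) * (\<Sum>i\<in>A. (norm (w i))\<^sup>2)"
proof -
  let ?S = "{I. I \<subseteq> A \<and> card I = k}"
  let ?b = "real ((card A - 2) choose (k - 1))"
  have fin: "finite ?S" using A by simp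
  have "(\<Sum>I\<in>?S. (norm (sum w I))\<^sup>2)
      = (\<Sum>I\<in>?S. \<Sum>i\<in>A. \<Sum>j\<in>A. (if i \<in> I \<and> j \<notin> I then - (w i \<bullet> w j) else 0))"
    using assms by (intro sum.cong refl norm_subset_sum_eq) auto
  also have "\<dots> = (\<Sum>i\<in>A. \<Sum>j\<in>A. \<Sum>I\<in>?S. (if i \<in> I \<and> j \<notin> I then - (w i \<bullet> w j) else 0))"
    by (subst sum.swap, intro sum.cong refl sum.swap)
  also have "\<dots> = (\<Sum>i\<in>A. \<Sum>j\<in>A. (if i = j then ?b * (norm (w i))\<^sup>2 else 0) - ?b * (w i \<bullet> w j))"
  proof (intro sum.cong refl)
    fix i j assume ij: "i \<in> A" "j \<in> A"
    show "(\<Sum>I\<in>?S. (if i \<in> I \<and> j \<notin> I then - (w i \<bullet> w j) else 0))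
        = (if i = j then ?b * (norm (w i))\<^sup>2 else 0) - ?b * (w i \<bullet> w j)"
    proof (cases "i = j")
      case False
      have "(\<Sum>I\<in>?S. (if i \<in> I \<and> j \<notin> I then - (w i \<bullet> w j) else 0))
          = (\<Sum>I\<in>?S \<inter> {I. i \<in> I \<and> j \<notin> I}. - (w i \<bullet> w j))"
        by (subst sum.inter_restrict[OF fin]) simp
      also have "?S \<inter> {I. i \<in> I \<and> j \<notin> I} = {I. I \<subseteq> A \<and> card I = k \<and> i \<in> I \<and> j \<notin> I}"
        by blast
      finally show ?thesis
        using False card_subsets_separating[OF A ij False \<open>k > 0\<close>] by simp
    qed (simp add: power2_norm_eq_inner)
  qed
  also have "\<dots> = ?b * (\<Sum>i\<in>A. (norm (w i))\<^sup>2) - ?b * (sum w A \<bullet> sum w A)"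
    using A by (simp add: sum_subtractf sum_distrib_left inner_sum_left inner_sum_right inner_commute)
  finally show ?thesis using w by simp
qed

text \<open>
  Some \<open>k\<close>-subset reaches the average over all \<open>k\<close>-subsets.
\<close>

lemma ex_large_subset_sum:
  fixes w :: "'i \<Rightarrow> 'a::real_inner"
  assumes A: "finite A" and w: "sum w A = 0" and k: "0 < k" "k < card A"
  shows "\<exists>I\<subseteq>A. card I = k \<and> real (k * (card A - k)) * (\<Sum>i\<in>A. (norm (w i))\<^sup>2)
      \<le> real (card A * (card A - 1)) * (norm (sum w I))\<^sup>2"
proof (rule ccontr)
  let ?S = "{I. I \<subseteq> A \<and> card I = k}" and ?N = "card A"
  let ?Q = "\<Sum>i\<in>A. (norm (w i))\<^sup>2"
  have card: "card ?S = ?N choose k" using A by (simp add: n_subsets)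
  have fin: "finite ?S" using A by simp
  have ne: "?S \<noteq> {}"
  proof -
    have "card ?S \<noteq> 0" unfolding card using k by simp
    then show ?thesis by (metis card.empty)
  qed
  assume neg: "\<not> ?thesis"
  then have small: "real (?N * (?N - 1)) * (norm (sum w I))\<^sup>2 < real (k * (?N - k)) * ?Q" if "I \<in> ?S" for I
    using that neg by (auto simp: not_le)
  have "(\<Sum>I\<in>?S. real (?N * (?N - 1)) * (norm (sum w I))\<^sup>2) < (\<Sum>I\<in>?S. real (k * (?N - k)) * ?Q)"
    by (rule sum_strict_mono[OF fin ne small])
  also have "\<dots> = real (k * (?N - k) * (?N choose k)) * ?Q"
    by (simp add: card)
  also have "\<dots> = real (?N * (?N - 1) * ((?N - 2) choose (k - 1))) * ?Q"
    by (simp only: binomial_separating[OF k])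
  also have "\<dots> = (\<Sum>I\<in>?S. real (?N * (?N - 1)) * (norm (sum w I))\<^sup>2)"
    unfolding sum_distrib_left[symmetric] sum_norm_subset_sums[OF A w \<open>0 < k\<close>] by simp
  finally show False by simp
qed

section \<open>Range and sum of squares\<close>

text \<open>
  For \<open>N \<ge> 1\<close> the left-hand side is a convex function of each \<open>b i\<close> separately, so moving the \<open>b i\<close> one
  after the other to a suitable endpoint of \<open>[0, 1]\<close> does not decrease it; \<open>j\<close> counts those moved
  to \<open>1\<close>. The offsets \<open>q\<close> and \<open>s\<close> carry the contribution of the elements already treated.
\<close>

lemma convex_variance_bound:
  fixes b :: "'i \<Rightarrow> real"
  assumes "finite A" "\<And>i. i \<in> A \<Longrightarrow> 0 \<le> b i \<and> b i \<le> 1" "1 \<le> N"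
  shows "\<exists>j. N * (q + (\<Sum>i\<in>A. (b i)\<^sup>2)) - (s + sum b A)\<^sup>2 \<le> N * (q + real j) - (s + real j)\<^sup>2"
  using assms(1,2)
proof (induction A arbitrary: q s rule: finite_induct)
  case empty
  show ?case by (rule exI[of _ 0]) simp
next
  case (insert x A)
  let ?c = "b x"
  have c: "0 \<le> ?c" "?c \<le> 1" using insert.prems by auto
  obtain j where j: "N * ((q + ?c\<^sup>2) + (\<Sum>i\<in>A. (b i)\<^sup>2)) - ((s + ?c) + sum b A)\<^sup>2
      \<le> N * ((q + ?c\<^sup>2) + real j) - ((s + ?c) + real j)\<^sup>2"
    using insert.IH[of "q + ?c\<^sup>2" "s + ?c"] insert.prems by auto
  define F where "F m = N * (q + m) - (s + m)\<^sup>2" for m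
  have "N * ((q + ?c\<^sup>2) + real j) - ((s + ?c) + real j)\<^sup>2
      = (1 - ?c) * F (real j) + ?c * F (real j + 1) - (N - 1) * (?c * (1 - ?c))"
    by (simp add: F_def power2_eq_square algebra_simps)
  also have "\<dots> \<le> (1 - ?c) * F (real j) + ?c * F (real j + 1)"
    using c \<open>1 \<le> N\<close> by simp
  also have "\<dots> \<le> max (F (real j)) (F (real j + 1))"
    using c by (intro convex_bound_le) auto
  finally have "N * ((q + ?c\<^sup>2) + (\<Sum>i\<in>A. (b i)\<^sup>2)) - ((s + ?c) + sum b A)\<^sup>2
      \<le> max (F (real j)) (F (real (Suc j)))"
    using j by (simp add: add.commute)
  then have "\<exists>j. N * ((q + ?c\<^sup>2) + (\<Sum>i\<in>A. (b i)\<^sup>2)) - ((s + ?c) + sum b A)\<^sup>2 \<le> F (real j)"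
    by (metis le_max_iff_disj)
  then show ?case
    using insert.hyps by (simp add: F_def add.assoc)
qed

lemma mult_diff_le_halves: "real j * (real N - real j) \<le> real ((N div 2) * (N - N div 2))"
proof (cases "j \<le> N")
  case True
  have *: "int j * (int N - int j) \<le> int (N div 2) * (int N - int (N div 2))"
  proof -
    define m where "m = int (N div 2)"
    define e where "e = int (N mod 2)"
    have e: "int N = 2 * m + e" "e = 0 \<or> e = 1"
      unfolding m_def e_def by presburger+
    define d where "d = int j - m"
    \<comment> \<open>\<open>d * (d - e)\<close> is never negative for an integer \<open>d\<close>, as \<open>e\<close> is \<open>0\<close> or \<open>1\<close>.\<close>
    have "m * (int N - m) - int j * (int N - int j) = d * (d - e)"
      using e(1) by (simp add: d_def algebra_simps)
    moreover have "0 \<le> d * (d - e)"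
      using e(2) by (cases "d \<le> 0") (auto simp: zero_le_mult_iff)
    ultimately show ?thesis by (simp add: m_def)
  qed
  have "int j * int (N - j) \<le> int (N div 2) * int (N - N div 2)"
    using * True by (simp add: of_nat_diff)
  then have "j * (N - j) \<le> (N div 2) * (N - N div 2)"
    by (simp only: of_nat_mult[symmetric] of_nat_le_iff)
  then have "real (j * (N - j)) \<le> real ((N div 2) * (N - N div 2))"
    by (simp only: of_nat_le_iff)
  then show ?thesis using True by (simp add: of_nat_diff)
next
  case False
  then have "real j * (real N - real j) \<le> 0" by (simp add: mult_le_0_iff)
  also have "0 \<le> real ((N div 2) * (N - N div 2))" by (rule of_nat_0_le_iff)
  finally show ?thesis .
qed

text \<open>
  Popoviciu's inequality on variances in its sharp form for a given number of points: for an odd number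
  of points the constant is smaller than the usual \<open>(card A)\<^sup>2 / 4\<close>.
\<close>

lemma sum_squares_le_range:
  fixes a :: "'i \<Rightarrow> real"
  assumes A: "finite A" "A \<noteq> {}" and a: "\<And>i. i \<in> A \<Longrightarrow> l \<le> a i \<and> a i \<le> l + W" and "sum a A = 0"
  shows "real (card A) * (\<Sum>i\<in>A. (a i)\<^sup>2) \<le> real ((card A div 2) * (card A - card A div 2)) * W\<^sup>2"
proof (cases "W = 0")
  case True
  then have "a i = l" if "i \<in> A" for i using a[OF that] by simp
  moreover from this have "l = 0" using \<open>sum a A = 0\<close> A by simp
  ultimately show ?thesis by simp
next
  case False
  let ?N = "real (card A)"
  have W: "W > 0" using a A False by force
  define b where "b i = (a i - l) / W" for i
  have b: "0 \<le> b i \<and> b i \<le> 1" if "i \<in> A" for i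
    using a[OF that] W by (simp add: b_def field_simps)
  have N: "1 \<le> ?N" using A by (simp add: Suc_leI card_gt_0_iff)
  obtain j where j: "?N * (\<Sum>i\<in>A. (b i)\<^sup>2) - (sum b A)\<^sup>2 \<le> ?N * real j - (real j)\<^sup>2"
    using convex_variance_bound[where A = A and b = b and N = ?N and q = 0 and s = 0] A(1) b N
    by auto
  have a_b: "a i = l + W * b i" for i using W by (simp add: b_def)
  have sum_b: "?N * l + W * sum b A = 0"
    using \<open>sum a A = 0\<close> by (simp add: a_b sum.distrib sum_distrib_left)
  have "?N * (\<Sum>i\<in>A. (a i)\<^sup>2) = ?N * (?N * l\<^sup>2 + 2 * l * W * sum b A + W\<^sup>2 * (\<Sum>i\<in>A. (b i)\<^sup>2))"
    by (simp add: a_b sum.distrib power_mult_distrib sum_distrib_left[symmetric]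
        power2_sum[of l] mult.assoc[symmetric] distrib_left)
  also have "\<dots> = W\<^sup>2 * (?N * (\<Sum>i\<in>A. (b i)\<^sup>2) - (sum b A)\<^sup>2) + (?N * l + W * sum b A)\<^sup>2"
    by (simp add: power2_eq_square algebra_simps)
  also have "\<dots> \<le> W\<^sup>2 * (?N * real j - (real j)\<^sup>2)"
    using j by (simp add: sum_b mult_left_mono)
  also have "\<dots> \<le> W\<^sup>2 * real ((card A div 2) * (card A - card A div 2))"
    using mult_diff_le_halves[of j "card A"]
    by (intro mult_left_mono) (simp_all add: power2_eq_square algebra_simps)
  finally show ?thesis by (simp add: mult.commute)
qed

section \<open>Width, contact points and Steinhagen's inequality\<close>

lemma inner_le_support_function:
  fixes S :: "'a::euclidean_space set"
  assumes "bounded S" "y \<in> S"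
  shows "y \<bullet> u \<le> support_function S u"
proof -
  have "bounded ((\<lambda>x. x \<bullet> u) ` S)"
    using assms(1) by (intro bounded_linear_image bounded_linear_inner_left)
  then show ?thesis
    unfolding support_function_def using assms(2)
    by (intro cSUP_upper bounded_imp_bdd_above)
qed

lemma width_times_norm_le:
  fixes S :: "'a::euclidean_space set"
  assumes S: "bounded S" "S \<noteq> {}" and v: "v \<noteq> 0"
    and a: "\<And>y. y \<in> S \<Longrightarrow> y \<bullet> v \<le> a" and b: "\<And>y. y \<in> S \<Longrightarrow> - b \<le> y \<bullet> v"
  shows "width S * norm v \<le> a + b"
proof -
  let ?h = "\<lambda>u. support_function S u + support_function S (- u)"
  define u where "u = v /\<^sub>R norm v"
  obtain y where "y \<in> S" using S by blast
  then have "0 \<le> ?h u" for u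
    using inner_le_support_function[OF S(1), of y u] inner_le_support_function[OF S(1), of y "- u"] by simp
  then have "bdd_below (?h ` sphere 0 1)" by (intro bdd_belowI2[where m = 0])
  moreover have "u \<in> sphere 0 1" using v by (simp add: u_def)
  ultimately have "width S \<le> ?h u"
    unfolding width_def by (rule cINF_lower)
  moreover have "support_function S u \<le> a / norm v"
    unfolding support_function_def using S a v
    by (intro cSUP_least) (auto simp: u_def field_simps)
  moreover have "support_function S (- u) \<le> b / norm v"
    unfolding support_function_def using S b v
    by (intro cSUP_least) (force simp: u_def field_simps)+
  ultimately have "width S \<le> (a + b) / norm v" by (simp add: add_divide_distrib)
  then show ?thesis using v by (simp add: field_simps)
qed

lemma le_widthI:
  fixes S :: "'a::euclidean_space set"
  assumes S: "bounded S" and w: "\<And>u. norm u = 1 \<Longrightarrow> \<exists>x\<in>S. \<exists>y\<in>S. w \<le> x \<bullet> u - y \<bullet> u"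
  shows "w \<le> width S"
  unfolding width_def
proof (rule cINF_greatest)
  show "sphere (0::'a) 1 \<noteq> {}" using vector_choose_size[of 1] by auto
  fix u :: 'a assume "u \<in> sphere 0 1"
  then obtain x y where "x \<in> S" "y \<in> S" "w \<le> x \<bullet> u - y \<bullet> u" using w[of u] by auto
  then show "w \<le> support_function S u + support_function S (- u)"
    using inner_le_support_function[OF S, of x u] inner_le_support_function[OF S, of y "- u"] by simp
qed

lemma width_ge_diameter_of_ball:
  fixes S :: "'a::euclidean_space set"
  assumes "bounded S" "cball x r \<subseteq> S" "0 \<le> r"
  shows "2 * r \<le> width S"
proof (rule le_widthI[OF assms(1)])
  fix u :: 'a assume u: "norm u = 1"
  have "x + r *\<^sub>R u \<in> S" "x - r *\<^sub>R u \<in> S"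
    using assms u by (auto simp: subset_iff dist_norm)
  moreover have "2 * r \<le> (x + r *\<^sub>R u) \<bullet> u - (x - r *\<^sub>R u) \<bullet> u"
    using u by (simp add: inner_diff_left inner_add_left dot_square_norm)
  ultimately show "\<exists>x\<in>S. \<exists>y\<in>S. 2 * r \<le> x \<bullet> u - y \<bullet> u" by blast
qed

text \<open>
  The supporting hyperplane of \<open>S\<close> at \<open>l\<close> also supports the ball, and the only hyperplane doing so is
  orthogonal to the radius (the equality case of Cauchy-Schwarz).
\<close>

lemma tangent_ball_supporting_halfspace:
  fixes S :: "'a::euclidean_space set"
  assumes S: "convex S" "closed S" and ball: "cball x r \<subseteq> S" and "0 < r"
    and l: "l \<in> frontier S" "dist x l = r" and y: "y \<in> S"
  shows "(y - x) \<bullet> ((l - x) /\<^sub>R r) \<le> r"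
proof -
  obtain n where n: "n \<noteq> 0" "\<And>y. y \<in> S \<Longrightarrow> y \<bullet> n \<le> l \<bullet> n"
    using frontier_supporting_normal[OF S l(1)] by blast
  have norm: "norm (l - x) = r" using l(2) by (simp add: dist_norm norm_minus_commute)
  have "x + (r / norm n) *\<^sub>R n \<in> S"
    using ball n(1) \<open>0 < r\<close> by (intro subsetD[OF ball]) (simp add: dist_norm)
  from n(2)[OF this] have "norm (l - x) * norm n \<le> (l - x) \<bullet> n"
    using n(1) by (simp add: norm inner_add_left inner_diff_left dot_square_norm power2_eq_square)
  then have "(l - x) \<bullet> n = norm (l - x) * norm n"
    using norm_cauchy_schwarz[of "l - x" n] by linarith
  then have "r *\<^sub>R n = norm n *\<^sub>R (l - x)"
    using norm_cauchy_schwarz_eq[of "l - x" n] norm by simp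
  then have "(1 / norm n) *\<^sub>R (r *\<^sub>R n) = (1 / norm n) *\<^sub>R (norm n *\<^sub>R (l - x))"
    by (rule arg_cong)
  then have l_x: "l - x = (r / norm n) *\<^sub>R n"
    using n(1) by simp
  have "(y - x) \<bullet> (l - x) \<le> (l - x) \<bullet> (l - x)"
  proof -
    have "(y - l) \<bullet> (l - x) \<le> 0"
      using n(2)[OF y] n(1) \<open>0 < r\<close>
      by (simp add: l_x inner_diff_left mult_le_0_iff divide_le_0_iff)
    moreover have "(y - x) \<bullet> (l - x) = (y - l) \<bullet> (l - x) + (l - x) \<bullet> (l - x)"
      by (simp add: algebra_simps)
    ultimately show ?thesis by simp
  qed
  then show ?thesis
    using norm \<open>0 < r\<close> by (simp add: dot_square_norm power2_eq_square divide_inverse_commute[symmetric] pos_divide_le_eq)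
qed

text \<open>
  The centre maximises the distance to the complement. If \<open>0\<close> were not in the convex hull of the contact
  normals, some direction \<open>a\<close> would have positive inner product with all of them, and moving the centre
  along \<open>- a\<close> would leave every contact point behind. Concretely: the moved centre \<open>z n\<close> has some
  \<open>y n\<close> in the closure of the complement within distance \<open>r\<close>; as \<open>y n\<close> is not closer than \<open>r\<close> to \<open>x\<close>,
  it satisfies \<open>(y n - x) \<bullet> a \<le> 0\<close>, and so does a limit point \<open>l\<close>, which is a contact point.
\<close>

lemma ex_inball_contact_normals:
  fixes S :: "'a::euclidean_space set"
  assumes S: "compact S" "convex S" "interior S \<noteq> {}"
  obtains x r where "0 < r" "cball x r \<subseteq> S"
    "0 \<in> convex hull {u. norm u = 1 \<and> (\<forall>y\<in>S. (y - x) \<bullet> u \<le> r)}"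
proof -
  have "closed S" using S compact_imp_closed by blast
  have "S \<noteq> UNIV" using S compact_imp_bounded not_bounded_UNIV by metis
  then have ne: "- S \<noteq> {}" by blast
  have cl: "closure (- S) = - interior S" by (rule closure_complement)
  have infdist_le': "infdist z (- S) \<le> dist z y" if "y \<in> closure (- S)" for z y
    using infdist_triangle[of z "- S" y] in_closure_iff_infdist_zero[OF ne, of y] that by simp
  obtain x where x: "x \<in> S" "\<And>z. z \<in> S \<Longrightarrow> infdist z (- S) \<le> infdist x (- S)"
    using continuous_attains_sup[OF S(1) _ continuous_on_infdist[OF continuous_on_id], of "- S"]
      S(3) interior_subset by (metis subset_empty)
  define r where "r = infdist x (- S)"
  have max: "infdist z (- S) \<le> r" for z
  proof (cases "z \<in> S")
    case False
    then have "infdist z (- S) = 0" by simp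
    then show ?thesis by (simp add: r_def infdist_nonneg)
  qed (simp add: x r_def)
  obtain p where "p \<in> interior S" using S(3) by blast
  then have "p \<notin> closure (- S)" by (simp add: cl)
  then have "0 < infdist p (- S)"
    using in_closure_iff_infdist_zero[OF ne, of p] infdist_nonneg[of p "- S"] by linarith
  then have "0 < r" using max[of p] by linarith
  have "x \<in> inner_parallel S r" using x by (simp add: inner_parallel_def r_def)
  then have ball: "cball x r \<subseteq> S"
    using inner_parallel_eq_cball[OF \<open>closed S\<close> \<open>S \<noteq> UNIV\<close>, of r] \<open>0 < r\<close> by simp
  define U where "U = {u. norm u = 1 \<and> (\<forall>y\<in>S. (y - x) \<bullet> u \<le> r)}"
  have "0 \<in> convex hull U"
  proof (rule ccontr)
    assume "0 \<notin> convex hull U"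
    have "U = sphere 0 1 \<inter> (\<Inter>y\<in>S. {u. (y - x) \<bullet> u \<le> r})" by (auto simp: U_def)
    then have "compact U"
      by (simp add: compact_Int_closed closed_INT closed_halfspace_le)
    then have "closed (convex hull U)" by (simp add: compact_convex_hull compact_imp_closed)
    then obtain a b where a: "a \<noteq> 0" "0 < b" "\<And>u. u \<in> convex hull U \<Longrightarrow> b < a \<bullet> u"
      using separating_hyperplane_closed_0[OF convex_convex_hull _ \<open>0 \<notin> convex hull U\<close>] by blast
    define z where "z n = x - (1 / Suc n) *\<^sub>R a" for n
    have "\<exists>y\<in>closure (- S). dist (z n) y \<le> r" for n
    proof -
      obtain y where "y \<in> closure (- S)" "infdist (z n) (closure (- S)) = dist (z n) y"
        using infdist_attains_inf[of "closure (- S)" "z n"] ne by auto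
      then show ?thesis
        using max[of "z n"] infdist_mono[OF closure_subset ne, of "z n"] by force
    qed
    then obtain y where y: "\<And>n. y n \<in> closure (- S)" "\<And>n. dist (z n) (y n) \<le> r" by metis
    have "y n \<in> closure (- S) \<inter> cball x (r + norm a)" for n
    proof -
      have "dist x (z n) \<le> norm a"
        by (simp add: z_def dist_norm divide_le_eq mult_le_cancel_left1)
      then have "dist x (y n) \<le> r + norm a"
        using dist_triangle[of x "y n" "z n"] y(2)[of n] by simp
      then show ?thesis using y(1) by simp
    qed
    moreover have "seq_compact (closure (- S) \<inter> cball x (r + norm a))"
      by (simp add: closed_Int_compact compact_imp_seq_compact)
    ultimately obtain l \<sigma> where l: "l \<in> closure (- S)" and \<sigma>: "strict_mono \<sigma>"
      and lim: "(y \<circ> \<sigma>) \<longlonglongrightarrow> l"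
      unfolding seq_compact_def by (metis IntD1)
    have inv: "(\<lambda>n. 1 / real (Suc n)) \<longlonglongrightarrow> 0"
      by (rule LIMSEQ_Suc) (rule lim_1_over_n)
    have "z \<longlonglongrightarrow> x - 0 *\<^sub>R a"
      unfolding z_def[abs_def] by (intro tendsto_intros inv)
    then have "z \<longlonglongrightarrow> x" by simp
    then have "(z \<circ> \<sigma>) \<longlonglongrightarrow> x"
      using \<sigma> by (rule LIMSEQ_subseq_LIMSEQ)
    then have "(\<lambda>n. dist ((z \<circ> \<sigma>) n) ((y \<circ> \<sigma>) n)) \<longlonglongrightarrow> dist x l"
      using lim by (rule tendsto_dist)
    then have "dist x l \<le> r"
      by (rule LIMSEQ_le_const2) (use y in auto)
    then have dist_l: "dist x l = r"
      using infdist_le'[OF l, of x] by (simp add: r_def)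
    have side: "(y n - x) \<bullet> a \<le> 0" for n
    proof -
      let ?e = "1 / real (Suc n)"
      have "r \<le> norm (y n - x)"
        using infdist_le'[OF y(1), of x n] by (simp add: r_def dist_norm norm_minus_commute)
      then have "r\<^sup>2 \<le> (norm (y n - x))\<^sup>2" using \<open>0 < r\<close> by (intro power_mono) auto
      moreover have "norm (y n - x + ?e *\<^sub>R a) \<le> r"
        using y(2)[of n] by (simp add: z_def dist_norm norm_minus_commute algebra_simps)
      then have "(norm (y n - x + ?e *\<^sub>R a))\<^sup>2 \<le> r\<^sup>2" by (intro power_mono) auto
      moreover have "(norm (y n - x + ?e *\<^sub>R a))\<^sup>2
          = (norm (y n - x))\<^sup>2 + 2 * ?e * ((y n - x) \<bullet> a) + (norm (?e *\<^sub>R a))\<^sup>2"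
        unfolding power2_norm_eq_inner by (simp add: inner_add_left inner_add_right inner_commute)
      ultimately have "2 * ?e * ((y n - x) \<bullet> a) \<le> 0"
        using zero_le_power2[of "norm (?e *\<^sub>R a)"] by linarith
      moreover have "0 < 2 * ?e" by simp
      ultimately show ?thesis by (metis mult_pos_pos not_le)
    qed
    have "(\<lambda>n. ((y \<circ> \<sigma>) n - x) \<bullet> a) \<longlonglongrightarrow> (l - x) \<bullet> a"
      by (intro tendsto_intros lim)
    then have "(l - x) \<bullet> a \<le> 0"
      by (rule LIMSEQ_le_const2) (use side in auto)
    moreover have "l \<in> frontier S"
      using l dist_l ball closure_subset[of S] by (auto simp: cl frontier_def)
    then have "(l - x) /\<^sub>R r \<in> U"
      using tangent_ball_supporting_halfspace[OF S(2) \<open>closed S\<close> ball \<open>0 < r\<close> _ dist_l]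
        dist_l \<open>0 < r\<close> by (simp add: U_def dist_norm norm_minus_commute)
    from a(3)[OF hull_inc[OF this]] have "0 < a \<bullet> ((l - x) /\<^sub>R r)" using a(2) by linarith
    then have "0 < (l - x) \<bullet> a" using \<open>0 < r\<close> by (simp add: inner_commute zero_less_mult_iff)
    ultimately show False by linarith
  qed
  then show thesis using that \<open>0 < r\<close> ball unfolding U_def by blast
qed

text \<open>
  The denominator under the root is the largest value of \<open>k * (n + 1 - k)\<close> for natural \<open>k\<close>. In
  this form, common to both parities, the constant arises in the averaging argument and in the simplex.
\<close>

definition steinhagen :: "nat \<Rightarrow> real" where
  "steinhagen n = real (n + 1) * sqrt (real n / real (((n + 1) div 2) * (n + 1 - (n + 1) div 2)))"

lemma steinhagen_odd:
  assumes "odd n"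
  shows "steinhagen n = 2 * sqrt (real n)"
proof -
  obtain m where n: "n = 2 * m + 1" using assms oddE by blast
  have "real (((n + 1) div 2) * (n + 1 - (n + 1) div 2)) = (real (m + 1))\<^sup>2"
    by (simp add: n power2_eq_square algebra_simps)
  then show ?thesis
    by (simp add: steinhagen_def real_sqrt_divide) (simp add: n field_simps)
qed

lemma steinhagen_even:
  assumes "even n" "n > 0"
  shows "steinhagen n = 2 * (real n + 1) / sqrt (real n + 2)"
proof -
  obtain m where n: "n = 2 * m" using assms evenE by blast
  have k: "((n + 1) div 2) * (n + 1 - (n + 1) div 2) = m * (m + 1)" by (simp add: n)
  have "real n / real (((n + 1) div 2) * (n + 1 - (n + 1) div 2)) = 2\<^sup>2 / (real n + 2)"
    unfolding k using assms(2) by (subst frac_eq_eq) (auto simp: n algebra_simps add_nonneg_eq_0_iff)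
  then show ?thesis
    by (simp add: steinhagen_def real_sqrt_divide)
qed

lemma steinhagen_sq:
  assumes "n > 0"
  shows "(steinhagen n)\<^sup>2 * real (((n + 1) div 2) * (n + 1 - (n + 1) div 2)) = (real (n + 1))\<^sup>2 * real n"
proof -
  have "((n + 1) div 2) * (n + 1 - (n + 1) div 2) > 0" using assms by (intro mult_pos_pos) auto
  then have "real (((n + 1) div 2) * (n + 1 - (n + 1) div 2)) > 0" by (simp only: of_nat_0_less_iff)
  then show ?thesis
    unfolding steinhagen_def power_mult_distrib
    by (subst real_sqrt_pow2) (auto simp del: of_nat_mult simp: field_simps)
qed

lemma steinhagen_pos: "n > 0 \<Longrightarrow> steinhagen n > 0"
  unfolding steinhagen_def by (auto intro!: mult_pos_pos divide_pos_pos simp del: of_nat_mult)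

text \<open>
  The weights \<open>\<nu>\<close> are extended by \<open>0\<close> to a set \<open>A\<close> of exactly \<open>n + 1\<close> elements, so that the averaging
  argument yields the constant of dimension \<open>n\<close> even when fewer contact points suffice. As the
  weights add up to \<open>1\<close>, the sum of their squares is at least \<open>1 / (n + 1)\<close>.
\<close>

theorem steinhagen_inequality:
  fixes S :: "'a::euclidean_space set"
  assumes S: "compact S" "convex S" "interior S \<noteq> {}"
  obtains x r where "0 < r" "cball x r \<subseteq> S" "width S \<le> steinhagen DIM('a) * r"
proof -
  let ?n = "DIM('a)" and ?N = "DIM('a) + 1"
  let ?k = "?N div 2"
  obtain x r where r: "0 < r" and ball: "cball x r \<subseteq> S"
    and "0 \<in> convex hull {u. norm u = 1 \<and> (\<forall>y\<in>S. (y - x) \<bullet> u \<le> r)}" (is "_ \<in> convex hull ?U")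
    using ex_inball_contact_normals[OF S] by blast
  then obtain T where T: "finite T" "T \<subseteq> ?U" "card T \<le> ?N" "0 \<in> convex hull T"
    unfolding caratheodory[of ?U] by blast
  then obtain \<mu> where \<mu>: "\<And>u. u \<in> T \<Longrightarrow> 0 \<le> \<mu> u" "sum \<mu> T = 1" "(\<Sum>u\<in>T. \<mu> u *\<^sub>R u) = 0"
    by (auto simp: convex_hull_finite)
  \<comment> \<open>The added elements serve as mere labels; their vectors \<open>w u\<close> vanish.\<close>
  have "infinite (UNIV :: 'a set)"
    using finite_imp_bounded not_bounded_UNIV by blast
  then have "infinite (- T)" using T(1) by (simp add: Compl_eq_Diff_UNIV)
  then obtain P where P: "finite P" "card P = ?N - card T" "P \<subseteq> - T"
    using infinite_arbitrarily_large by blast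
  define A where "A = T \<union> P"
  have A: "finite A" "T \<subseteq> A" using T P by (auto simp: A_def)
  have "card A = card T + card P"
    unfolding A_def using T(1) P by (intro card_Un_disjoint) auto
  then have card: "card A = ?N" using P(2) T(3) by simp
  define \<nu> where "\<nu> u = (if u \<in> T then \<mu> u else 0)" for u
  define w where "w u = \<nu> u *\<^sub>R u" for u
  have sum_\<nu>: "sum \<nu> A = 1"
    using \<mu>(2) A sum.mono_neutral_cong_right[of A T \<nu> \<mu>] by (simp add: \<nu>_def)
  have sum_w: "sum w A = 0"
    using \<mu>(3) A sum.mono_neutral_cong_right[of A T w "\<lambda>u. \<mu> u *\<^sub>R u"] by (simp add: w_def \<nu>_def)
  have norm_w: "norm (w u) = \<nu> u" for u
    using T(2) \<mu>(1) by (auto simp: w_def \<nu>_def)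
  have side: "(y - x) \<bullet> w u \<le> r * \<nu> u" if "y \<in> S" for y u
  proof (cases "u \<in> T")
    case True
    then have "(y - x) \<bullet> u \<le> r" using T(2) that by auto
    then have "\<mu> u * ((y - x) \<bullet> u) \<le> \<mu> u * r" by (intro mult_left_mono \<mu>(1) True)
    then show ?thesis using True by (simp add: w_def \<nu>_def mult.commute)
  qed (simp add: w_def \<nu>_def)
  obtain I where I: "I \<subseteq> A"
    "real (?k * (?N - ?k)) * (\<Sum>u\<in>A. (norm (w u))\<^sup>2) \<le> real (?N * ?n) * (norm (sum w I))\<^sup>2"
    using ex_large_subset_sum[OF A(1) sum_w, of ?k] card by auto
  define v where "v = sum w I"
  have "1 \<le> steinhagen ?n * norm v"
  proof -
    let ?q = "real (?k * (?N - ?k))"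
    have "?k * (?N - ?k) > 0" by (intro mult_pos_pos) auto
    then have q: "?q > 0" by (simp only: of_nat_0_less_iff)
    have "?q * 1 \<le> ?q * ((\<Sum>u\<in>A. (\<nu> u)\<^sup>2) * ?N)"
      using sum_squared_le_sum_of_squares[of \<nu> A] sum_\<nu> card q
      by (intro mult_left_mono) (auto simp del: of_nat_mult)
    also have "\<dots> = (?q * (\<Sum>u\<in>A. (norm (w u))\<^sup>2)) * ?N"
      by (simp only: norm_w mult.assoc)
    also have "\<dots> \<le> (real (?N * ?n) * (norm v)\<^sup>2) * ?N"
      using I(2) unfolding v_def by (intro mult_right_mono) auto
    also have "\<dots> = ((real ?N)\<^sup>2 * real ?n) * (norm v)\<^sup>2"
      by (simp only: of_nat_mult power2_eq_square mult_ac)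
    also have "\<dots> = ?q * (steinhagen ?n * norm v)\<^sup>2"
      unfolding steinhagen_sq[OF DIM_positive, symmetric] power_mult_distrib
      by (simp only: mult_ac)
    finally have "1\<^sup>2 \<le> (steinhagen ?n * norm v)\<^sup>2"
      using q by (simp only: mult_le_cancel_left_pos one_power2)
    then show ?thesis
      by (rule power2_le_imp_le) (simp add: steinhagen_pos less_imp_le)
  qed
  then have "v \<noteq> 0" by auto
  have "width S * norm v \<le> (x \<bullet> v + r * sum \<nu> I) + (r * sum \<nu> (A - I) - x \<bullet> v)"
  proof (rule width_times_norm_le)
    show "bounded S" "S \<noteq> {}" "v \<noteq> 0"
      using S \<open>v \<noteq> 0\<close> by (auto simp: compact_imp_bounded)
  next
    have bound: "(y - x) \<bullet> sum w J \<le> r * sum \<nu> J" if "y \<in> S" for y J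
      unfolding inner_sum_right sum_distrib_left by (intro sum_mono side that)
    show "y \<bullet> v \<le> x \<bullet> v + r * sum \<nu> I" if "y \<in> S" for y
      using bound[OF that, of I] by (simp add: v_def inner_diff_left)
    have "sum w (A - I) + v = 0"
      unfolding v_def sum.subset_diff[OF I(1) A(1), symmetric] by (fact sum_w)
    then have "sum w (A - I) = - v" by (simp add: eq_neg_iff_add_eq_0)
    then show "- (r * sum \<nu> (A - I) - x \<bullet> v) \<le> y \<bullet> v" if "y \<in> S" for y
      using bound[OF that, of "A - I"] by (simp add: inner_diff_left)
  qed
  also have "\<dots> = r * (sum \<nu> (A - I) + sum \<nu> I)" by (simp add: algebra_simps)
  also have "\<dots> = r"
    unfolding sum.subset_diff[OF I(1) A(1), symmetric] by (simp add: sum_\<nu>)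
  also have "\<dots> \<le> r * (steinhagen ?n * norm v)"
    using \<open>1 \<le> steinhagen ?n * norm v\<close> r by simp
  finally have "width S * norm v \<le> (steinhagen ?n * r) * norm v" by (simp add: mult_ac)
  then have "width S \<le> steinhagen ?n * r"
    using \<open>v \<noteq> 0\<close> by simp
  then show thesis using that r ball by blast
qed

section \<open>Inner parallel sets of convex bodies\<close>

lemma inner_parallel_compact_eq:
  fixes S :: "'a::euclidean_space set"
  assumes "compact S" "0 \<le> t"
  shows "inner_parallel S t = {x. cball x t \<subseteq> S}"
  using inner_parallel_eq_cball[of S t] assms compact_imp_closed compact_imp_bounded not_bounded_UNIV
  by metis

lemma inner_parallel_subset:
  fixes S :: "'a::euclidean_space set"
  shows "inner_parallel S t \<subseteq> S"
  by (auto simp: inner_parallel_def)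

lemma convex_inner_parallel:
  fixes S :: "'a::euclidean_space set"
  assumes "compact S" "convex S" "0 \<le> t"
  shows "convex (inner_parallel S t)"
proof (rule convexI)
  fix x y and u v :: real
  assume xy: "x \<in> inner_parallel S t" "y \<in> inner_parallel S t" and uv: "0 \<le> u" "0 \<le> v" "u + v = 1"
  have "z \<in> S" if "z \<in> cball (u *\<^sub>R x + v *\<^sub>R y) t" for z
  proof -
    define d where "d = z - (u *\<^sub>R x + v *\<^sub>R y)"
    have "norm d \<le> t" using that by (simp add: d_def dist_norm norm_minus_commute)
    then have "x + d \<in> S" "y + d \<in> S"
      using xy assms by (auto simp: inner_parallel_compact_eq subset_iff dist_norm)
    then have "u *\<^sub>R (x + d) + v *\<^sub>R (y + d) \<in> S" by (intro convexD assms uv)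
    moreover have "u *\<^sub>R (x + d) + v *\<^sub>R (y + d) = u *\<^sub>R x + v *\<^sub>R y + (u + v) *\<^sub>R d"
      by (simp add: algebra_simps)
    ultimately show ?thesis by (simp add: uv d_def)
  qed
  then show "u *\<^sub>R x + v *\<^sub>R y \<in> inner_parallel S t"
    using assms by (auto simp: inner_parallel_compact_eq)
qed

lemma closed_inner_parallel:
  fixes S :: "'a::euclidean_space set"
  assumes "closed S"
  shows "closed (inner_parallel S t)"
proof -
  have "inner_parallel S t = S \<inter> {x. t \<le> infdist x (- S)}" by (auto simp: inner_parallel_def)
  then show ?thesis
    using assms by (auto intro!: closed_Int closed_Collect_le continuous_intros)
qed

text \<open>
  A point within distance \<open>t\<close> of the shrunk copy is a convex combination, with weights \<open>1 - t / r\<close> and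
  \<open>t / r\<close>, of a point of \<open>S\<close> and a point of the ball.
\<close>

lemma homothety_subset_inner_parallel:
  fixes S :: "'a::euclidean_space set"
  assumes S: "compact S" "convex S" and ball: "cball x r \<subseteq> S" and t: "0 \<le> t" "t < r"
  shows "homothety x (1 - t / r) ` S \<subseteq> inner_parallel S t"
proof -
  have "z \<in> S" if "y \<in> S" "dist (homothety x (1 - t / r) y) z \<le> t" for y z
  proof (cases "t = 0")
    case True
    then show ?thesis using that by (simp add: homothety_def)
  next
    case False
    define d where "d = z - homothety x (1 - t / r) y"
    have "norm d \<le> t" using that by (simp add: d_def dist_norm norm_minus_commute)
    then have "norm ((r / t) *\<^sub>R d) \<le> r"
      using t False by (simp add: field_simps mult_left_mono)
    then have "x + (r / t) *\<^sub>R d \<in> S" using ball by (auto simp: subset_iff dist_norm)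
    then have "(1 - t / r) *\<^sub>R y + (t / r) *\<^sub>R (x + (r / t) *\<^sub>R d) \<in> S"
      using t that by (intro convexD[OF S(2)]) (auto simp: field_simps)
    moreover have "(1 - t / r) *\<^sub>R y + (t / r) *\<^sub>R (x + (r / t) *\<^sub>R d) = homothety x (1 - t / r) y + d"
      using t False by (simp add: homothety_def algebra_simps)
    ultimately show ?thesis by (simp add: d_def)
  qed
  then show ?thesis
    using S t by (auto simp: inner_parallel_compact_eq)
qed

lemma compact_convex_homothety:
  fixes S :: "'a::euclidean_space set"
  assumes "compact S" "convex S"
  shows "compact (homothety c s ` S)" "convex (homothety c s ` S)"
proof -
  have "homothety c s ` S = (\<lambda>x. (c - s *\<^sub>R c) + s *\<^sub>R x) ` S"
    by (intro image_cong refl) (simp add: homothety_def algebra_simps)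
  then show "compact (homothety c s ` S)" "convex (homothety c s ` S)"
    using compact_affinity[OF assms(1)] convex_affinity[OF assms(2)] by simp_all
qed

lemma perimeter_inner_parallel_ge:
  fixes S :: "'a::euclidean_space set"
  assumes dim: "DIM('a) \<ge> 2" and S: "compact S" "convex S"
    and ball: "cball x r \<subseteq> S" and "0 < r" "0 \<le> t"
  shows "ennreal (max 0 (1 - t / r) ^ (DIM('a) - 1)) * perimeter S \<le> perimeter (inner_parallel S t)"
proof (cases "t < r")
  case True
  then have s: "0 < 1 - t / r" using \<open>0 < r\<close> by simp
  have "perimeter (homothety x (1 - t / r) ` S) \<le> perimeter (inner_parallel S t)"
    using S compact_convex_homothety[OF S] homothety_subset_inner_parallel[OF S ball \<open>0 \<le> t\<close> True]
      inner_parallel_subset[of S t]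
    by (intro perimeter_mono) (auto intro: compact_imp_closed compact_imp_bounded bounded_subset)
  then show ?thesis using s by (simp add: perimeter_homothety)
next
  case False
  then have "max 0 (1 - t / r) = 0" using \<open>0 < r\<close> by (simp add: max_def)
  then show ?thesis using dim by (simp add: power_0_left)
qed

section \<open>Regular simplices\<close>

locale regular_simplex_vertices =
  fixes V :: "'a::euclidean_space set" and d :: real
  assumes card_V: "card V = DIM('a) + 1"
    and indep: "\<not> affine_dependent V"
    and equidistant: "\<And>x y. x \<in> V \<Longrightarrow> y \<in> V \<Longrightarrow> x \<noteq> y \<Longrightarrow> dist x y = d"
begin

definition N :: real where "N = real (card V)"

lemma N_eq: "N = real DIM('a) + 1"
  by (simp add: N_def card_V)

lemma N_pos: "0 < N"
  by (simp add: N_eq)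

definition centroid :: 'a where
  "centroid = (1 / N) *\<^sub>R (\<Sum>x\<in>V. x)"

definition rad :: "'a \<Rightarrow> 'a" where
  "rad x = x - centroid"

lemma finite_V: "finite V" and V_nonempty: "V \<noteq> {}"
  using card_V by (auto intro: card_ge_0_finite)

lemma d_pos: "0 < d"
proof -
  have "\<not> is_singleton V" using card_V by (simp add: is_singleton_altdef)
  then obtain x y where "x \<in> V" "y \<in> V" "x \<noteq> y"
    using V_nonempty by (meson is_singletonI' )
  then show ?thesis using equidistant zero_less_dist_iff by metis
qed

lemma sum_rad: "(\<Sum>x\<in>V. rad x) = 0"
proof -
  have "N *\<^sub>R centroid = (\<Sum>x\<in>V. x)" using N_pos by (simp add: centroid_def)
  then show ?thesis
    by (simp add: rad_def sum_subtractf sum_constant_scaleR flip: N_def)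
qed

text \<open>
  Summing the known squared distances from one vertex determines its distance from the centroid up to
  the constant \<open>Q\<close>, and summing once more determines \<open>Q\<close>; polarisation gives the remaining products.
\<close>

lemma inner_rad:
  assumes "x \<in> V" "y \<in> V"
  shows "rad x \<bullet> rad y = (if x = y then d\<^sup>2 / 2 else 0) - d\<^sup>2 / (2 * N)"
proof -
  define Q where "Q = (\<Sum>x\<in>V. rad x \<bullet> rad x)"
  have dist: "rad x \<bullet> rad x + rad y \<bullet> rad y - 2 * (rad x \<bullet> rad y) = (if x = y then 0 else d\<^sup>2)"
    if "x \<in> V" "y \<in> V" for x y
  proof -
    have "rad x \<bullet> rad x + rad y \<bullet> rad y - 2 * (rad x \<bullet> rad y) = (norm (rad x - rad y))\<^sup>2"
      by (simp add: power2_norm_eq_inner inner_diff_left inner_diff_right inner_commute)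
    also have "norm (rad x - rad y) = dist x y" by (simp add: rad_def dist_norm)
    finally show ?thesis using equidistant[OF that] by auto
  qed
  have row: "N * (rad x \<bullet> rad x) + Q = (N - 1) * d\<^sup>2" if "x \<in> V" for x
  proof -
    have "N * (rad x \<bullet> rad x) + Q - 2 * (rad x \<bullet> (\<Sum>y\<in>V. rad y))
        = (\<Sum>y\<in>V. rad x \<bullet> rad x + rad y \<bullet> rad y - 2 * (rad x \<bullet> rad y))"
      by (simp add: sum.distrib sum_subtractf sum_distrib_left inner_sum_right Q_def flip: N_def)
    also have "\<dots> = (\<Sum>y\<in>V. if x = y then 0 else d\<^sup>2)"
      by (intro sum.cong refl dist that)
    also have "\<dots> = (\<Sum>y\<in>V - {x}. d\<^sup>2)"
      using finite_V by (intro sum.mono_neutral_cong_right) auto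
    also have "\<dots> = (N - 1) * d\<^sup>2"
      using that finite_V by (simp add: N_def card_V)
    finally show ?thesis by (simp add: sum_rad)
  qed
  have "(\<Sum>x\<in>V. N * (rad x \<bullet> rad x) + Q) = (\<Sum>x\<in>V. (N - 1) * d\<^sup>2)"
    by (intro sum.cong refl row)
  then have "2 * N * Q = N * ((N - 1) * d\<^sup>2)"
    by (simp add: sum.distrib sum_distrib_left[symmetric] Q_def[symmetric] N_def[symmetric])
  then have Q: "2 * Q = (N - 1) * d\<^sup>2" using N_pos by simp
  have diag: "rad x \<bullet> rad x = d\<^sup>2 / 2 - d\<^sup>2 / (2 * N)" if "x \<in> V" for x
  proof -
    have "2 * N * (rad x \<bullet> rad x) = (N - 1) * d\<^sup>2" using row[OF that] Q by simp
    then show ?thesis using N_pos by (simp add: field_simps)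
  qed
  show ?thesis using dist[OF assms] diag assms by (auto split: if_splits)
qed

text \<open>
  The barycentric coordinates are affine functions of the inner products with the vectors \<open>rad y\<close>, which turns
  nonnegativity of the coordinates into a description of the simplex by half-spaces.
\<close>

lemma barycentric:
  obtains \<beta> where "sum \<beta> V = 1" "z = centroid + (\<Sum>x\<in>V. \<beta> x *\<^sub>R rad x)"
    "\<And>y. y \<in> V \<Longrightarrow> (z - centroid) \<bullet> rad y = d\<^sup>2 / 2 * (\<beta> y - 1 / N)"
    "z = (\<Sum>x\<in>V. \<beta> x *\<^sub>R x)"
proof -
  have "z \<in> affine hull V"
    using affine_independent_span_eq[OF indep] card_V by simp
  then obtain \<beta> where \<beta>: "sum \<beta> V = 1" "z = (\<Sum>x\<in>V. \<beta> x *\<^sub>R x)"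
    using affine_hull_finite[OF finite_V] by auto
  have z: "z = centroid + (\<Sum>x\<in>V. \<beta> x *\<^sub>R rad x)"
    using \<beta> by (simp add: rad_def scaleR_diff_right sum_subtractf flip: scaleR_sum_left)
  have "(z - centroid) \<bullet> rad y = d\<^sup>2 / 2 * (\<beta> y - 1 / N)" if "y \<in> V" for y
  proof -
    have "(z - centroid) \<bullet> rad y = (\<Sum>x\<in>V. \<beta> x * (rad x \<bullet> rad y))"
      by (subst z) (simp add: inner_sum_left)
    also have "\<dots> = (\<Sum>x\<in>V. (if x = y then \<beta> x * (d\<^sup>2 / 2) else 0) - \<beta> x * (d\<^sup>2 / (2 * N)))"
      using that by (intro sum.cong refl) (simp add: inner_rad algebra_simps)
    also have "\<dots> = \<beta> y * (d\<^sup>2 / 2) - sum \<beta> V * (d\<^sup>2 / (2 * N))"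
      using that finite_V by (simp add: sum_subtractf sum_distrib_right sum_divide_distrib)
    finally show ?thesis by (simp add: \<beta>(1) field_simps)
  qed
  then show thesis using that \<beta> z by blast
qed

lemma simplex_subset_halfspaces:
  assumes "z \<in> convex hull V" "y \<in> V"
  shows "- d\<^sup>2 / (2 * N) \<le> (z - centroid) \<bullet> rad y"
proof -
  have "convex {z. - d\<^sup>2 / (2 * N) + rad y \<bullet> centroid \<le> rad y \<bullet> z}"
    using convex_halfspace_ge[of _ "rad y"] by simp
  moreover have "V \<subseteq> {z. - d\<^sup>2 / (2 * N) + rad y \<bullet> centroid \<le> rad y \<bullet> z}"
  proof
    fix x assume "x \<in> V"
    then have "- d\<^sup>2 / (2 * N) \<le> rad x \<bullet> rad y"
      using assms(2) N_pos by (simp add: inner_rad)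
    then show "x \<in> {z. - d\<^sup>2 / (2 * N) + rad y \<bullet> centroid \<le> rad y \<bullet> z}"
      by (simp add: rad_def[of x] inner_diff_left inner_commute[of "rad y"])
  qed
  ultimately have "convex hull V \<subseteq> {z. - d\<^sup>2 / (2 * N) + rad y \<bullet> centroid \<le> rad y \<bullet> z}"
    by (simp add: hull_minimal)
  then show ?thesis using assms(1) by (auto simp: inner_diff_left inner_commute[of "rad y"])
qed

lemma in_simplexI:
  assumes "\<And>y. y \<in> V \<Longrightarrow> - d\<^sup>2 / (2 * N) \<le> (z - centroid) \<bullet> rad y"
  shows "z \<in> convex hull V"
proof -
  obtain \<beta> where \<beta>: "sum \<beta> V = 1" "z = (\<Sum>x\<in>V. \<beta> x *\<^sub>R x)"
    "\<And>y. y \<in> V \<Longrightarrow> (z - centroid) \<bullet> rad y = d\<^sup>2 / 2 * (\<beta> y - 1 / N)"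
    by (rule barycentric[of z]) blast
  have "0 \<le> \<beta> y" if "y \<in> V" for y
  proof -
    have "0 \<le> d\<^sup>2 / 2 * \<beta> y"
      using assms[OF that] \<beta>(3)[OF that] by (simp add: field_simps)
    then show ?thesis using d_pos by (simp add: zero_le_mult_iff)
  qed
  then show ?thesis
    using \<beta>(1,2) by (auto simp: convex_hull_finite[OF finite_V])
qed

text \<open>
  By lemma \<open>barycentric\<close>, \<open>p\<close> is the combination of the vectors \<open>rad y\<close> with the coefficients
  \<open>1 / N + 2 / d\<^sup>2 * (p \<bullet> rad y)\<close>; their constant part drops out because the vectors have sum zero.
\<close>

lemma tight_frame: "(\<Sum>y\<in>V. (p \<bullet> rad y)\<^sup>2) = d\<^sup>2 / 2 * (norm p)\<^sup>2"
proof -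
  obtain \<beta> where \<beta>: "p + centroid = centroid + (\<Sum>x\<in>V. \<beta> x *\<^sub>R rad x)"
    "\<And>y. y \<in> V \<Longrightarrow> (p + centroid - centroid) \<bullet> rad y = d\<^sup>2 / 2 * (\<beta> y - 1 / N)"
    by (rule barycentric[of "p + centroid"]) blast
  have p: "p = (\<Sum>x\<in>V. \<beta> x *\<^sub>R rad x)" using \<beta>(1) by simp
  have "d\<^sup>2 / 2 * (norm p)\<^sup>2 = d\<^sup>2 / 2 * (p \<bullet> (\<Sum>x\<in>V. \<beta> x *\<^sub>R rad x) - 1 / N * (p \<bullet> (\<Sum>x\<in>V. rad x)))"
    by (simp add: power2_norm_eq_inner sum_rad p[symmetric])
  also have "\<dots> = (\<Sum>y\<in>V. (d\<^sup>2 / 2 * (\<beta> y - 1 / N)) * (p \<bullet> rad y))"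
    unfolding inner_sum_right sum_distrib_left sum_subtractf[symmetric]
    by (intro sum.cong refl) (simp add: algebra_simps)
  also have "\<dots> = (\<Sum>y\<in>V. (p \<bullet> rad y)\<^sup>2)"
    using \<beta>(2) by (intro sum.cong refl) (simp add: power2_eq_square)
  finally show ?thesis by simp
qed

definition circumradius :: real where "circumradius = d * sqrt (real DIM('a) / (2 * N))"

definition inradius :: real where "inradius = d / sqrt (2 * N * real DIM('a))"

lemma circumradius_pos: "0 < circumradius" and inradius_pos: "0 < inradius"
  using d_pos N_pos by (simp_all add: circumradius_def inradius_def)

lemma norm_rad: "x \<in> V \<Longrightarrow> norm (rad x) = circumradius"
proof -
  assume "x \<in> V"
  then have "(norm (rad x))\<^sup>2 = circumradius\<^sup>2"
    using N_pos by (simp add: power2_norm_eq_inner inner_rad circumradius_def power_mult_distrib N_eq field_simps)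
  then show ?thesis using circumradius_pos by simp
qed

lemma inradius_circumradius: "inradius * circumradius = d\<^sup>2 / (2 * N)"
proof -
  have "(sqrt (2 * N * real DIM('a)) / (2 * N))\<^sup>2 = real DIM('a) / (2 * N)"
    using N_pos by (simp add: power_divide) (simp add: power2_eq_square)
  then have "sqrt (real DIM('a) / (2 * N)) = sqrt (2 * N * real DIM('a)) / (2 * N)"
    using N_pos by (intro real_sqrt_unique) auto
  then show ?thesis
    using N_pos by (simp add: circumradius_def inradius_def power2_eq_square)
qed

text \<open>
  The point of the ball about \<open>z\<close> that is nearest to the facet opposite \<open>y\<close> still lies in the simplex.
\<close>

lemma inner_parallel_halfspaces:
  assumes z: "z \<in> inner_parallel (convex hull V) t" and "0 \<le> t" and y: "y \<in> V"
  shows "- ((inradius - t) * circumradius) \<le> (z - centroid) \<bullet> rad y"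
proof -
  have "cball z t \<subseteq> convex hull V"
    using z \<open>0 \<le> t\<close> finite_V by (simp add: inner_parallel_compact_eq finite_imp_compact_convex_hull)
  then have "z - (t / circumradius) *\<^sub>R rad y \<in> convex hull V"
    using circumradius_pos y \<open>0 \<le> t\<close> by (auto simp: subset_iff dist_norm norm_rad)
  from simplex_subset_halfspaces[OF this y]
  have "- (inradius * circumradius) \<le> (z - centroid) \<bullet> rad y - (t / circumradius) * (rad y \<bullet> rad y)"
    by (simp add: inradius_circumradius inner_diff_left)
  also have "rad y \<bullet> rad y = circumradius\<^sup>2" using norm_rad[OF y] by (simp flip: power2_norm_eq_inner)
  finally show ?thesis using circumradius_pos by (simp add: power2_eq_square algebra_simps)
qed

lemma inner_parallel_subset_homothety:
  assumes "0 \<le> t" "t < inradius"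
  shows "inner_parallel (convex hull V) t \<subseteq> homothety centroid (1 - t / inradius) ` (convex hull V)"
proof
  fix z assume z: "z \<in> inner_parallel (convex hull V) t"
  define s where "s = 1 - t / inradius"
  have s: "0 < s" "inradius - t = s * inradius" using assms by (simp_all add: s_def field_simps)
  have "homothety centroid (1 / s) z \<in> convex hull V"
  proof (rule in_simplexI)
    fix y assume y: "y \<in> V"
    have "- (s * (inradius * circumradius)) \<le> (z - centroid) \<bullet> rad y"
      using inner_parallel_halfspaces[OF z \<open>0 \<le> t\<close> y] s(2) by (simp add: mult.assoc)
    then have "- (inradius * circumradius) \<le> ((z - centroid) \<bullet> rad y) / s"
      using s(1) by (simp add: pos_le_divide_eq mult_ac)
    also have "\<dots> = (homothety centroid (1 / s) z - centroid) \<bullet> rad y"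
      by (simp add: homothety_def)
    finally show "- d\<^sup>2 / (2 * N) \<le> (homothety centroid (1 / s) z - centroid) \<bullet> rad y"
      by (simp add: inradius_circumradius)
  qed
  moreover have "z = homothety centroid s (homothety centroid (1 / s) z)"
    using s(1) by (simp add: homothety_def)
  ultimately show "z \<in> homothety centroid (1 - t / inradius) ` (convex hull V)"
    unfolding s_def by blast
qed

text \<open>
  The inner products with the vertices are all nonnegative but have sum zero.
\<close>

lemma inner_parallel_subset_centroid:
  assumes "inradius \<le> t"
  shows "inner_parallel (convex hull V) t \<subseteq> {centroid}"
proof
  fix z assume z: "z \<in> inner_parallel (convex hull V) t"
  have t: "0 \<le> t" using assms inradius_pos by linarith
  have nonneg: "0 \<le> (z - centroid) \<bullet> rad y" if "y \<in> V" for y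
  proof -
    have "(inradius - t) * circumradius \<le> 0" using assms circumradius_pos by (simp add: mult_le_0_iff)
    then show ?thesis using inner_parallel_halfspaces[OF z t that] by linarith
  qed
  have "(\<Sum>y\<in>V. (z - centroid) \<bullet> rad y) = 0"
    by (simp add: sum_rad flip: inner_sum_right)
  then have "(z - centroid) \<bullet> rad y = 0" if "y \<in> V" for y
    using that sum_nonneg_eq_0_iff[of V "\<lambda>y. (z - centroid) \<bullet> rad y"] finite_V nonneg by simp
  then have "d\<^sup>2 / 2 * (norm (z - centroid))\<^sup>2 = 0"
    unfolding tight_frame[symmetric] by simp
  then show "z \<in> {centroid}" using d_pos by simp
qed

text \<open>
  For a unit vector \<open>u\<close>, lemma \<open>tight_frame\<close> fixes the sum of squares of the heights of the vertices
  over the centroid, and \<open>sum_squares_le_range\<close> bounds the difference of the extreme heights below.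
\<close>

lemma steinhagen_le_width: "steinhagen DIM('a) * inradius \<le> width (convex hull V)"
proof (rule le_widthI)
  show "bounded (convex hull V)"
    using finite_V by (simp add: bounded_convex_hull finite_imp_bounded)
  fix u :: 'a assume u: "norm u = 1"
  let ?q = "real ((DIM('a) + 1) div 2 * (DIM('a) + 1 - (DIM('a) + 1) div 2))"
  define a where "a y = u \<bullet> rad y" for y
  obtain x where x: "x \<in> V" "\<And>y. y \<in> V \<Longrightarrow> a y \<le> a x"
    using Max_in[of "a ` V"] Max_ge[of "a ` V"] finite_V V_nonempty
    by (metis (no_types, lifting) finite_imageI image_iff image_is_empty)
  obtain y where y: "y \<in> V" "\<And>z. z \<in> V \<Longrightarrow> a y \<le> a z"
    using Min_in[of "a ` V"] Min_le[of "a ` V"] finite_V V_nonempty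
    by (metis (no_types, lifting) finite_imageI image_iff image_is_empty)
  have "(DIM('a) + 1) div 2 * (DIM('a) + 1 - (DIM('a) + 1) div 2) > 0"
    by (intro mult_pos_pos) (auto simp: Suc_le_eq div_greater_zero_iff)
  then have q: "?q > 0" by (simp only: of_nat_0_less_iff)
  have spread: "N * (\<Sum>y\<in>V. (a y)\<^sup>2) \<le> ?q * (a x - a y)\<^sup>2"
    using sum_squares_le_range[OF finite_V V_nonempty, of "a y" a "a x - a y"] x y
    by (simp add: a_def N_def card_V sum_rad flip: inner_sum_right)
  have sum_sq: "(\<Sum>y\<in>V. (a y)\<^sup>2) = d\<^sup>2 / 2"
    using tight_frame[of u] u by (simp add: a_def)
  have "?q * (steinhagen DIM('a) * inradius)\<^sup>2 = N * (d\<^sup>2 / 2)"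
  proof -
    have "?q * (steinhagen DIM('a) * inradius)\<^sup>2 = ((steinhagen DIM('a))\<^sup>2 * ?q) * inradius\<^sup>2"
      by (simp only: power_mult_distrib mult_ac)
    also have "\<dots> = N\<^sup>2 * real DIM('a) * (d\<^sup>2 / (2 * N * real DIM('a)))"
      using N_pos by (simp only: steinhagen_sq[OF DIM_positive] inradius_def power_divide) (simp add: N_eq)
    also have "\<dots> = N * (d\<^sup>2 / 2)" using N_pos by (simp add: power2_eq_square)
    finally show ?thesis .
  qed
  also have "\<dots> \<le> ?q * (a x - a y)\<^sup>2" using spread unfolding sum_sq .
  finally have "?q * (steinhagen DIM('a) * inradius)\<^sup>2 \<le> ?q * (a x - a y)\<^sup>2" .
  then have "(steinhagen DIM('a) * inradius)\<^sup>2 \<le> (a x - a y)\<^sup>2"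
    using q by (simp only: mult_le_cancel_left_pos)
  then have "steinhagen DIM('a) * inradius \<le> a x - a y"
    by (rule power2_le_imp_le) (use x(2)[OF y(1)] in simp)
  also have "\<dots> = x \<bullet> u - y \<bullet> u"
    by (simp add: a_def rad_def inner_diff_right inner_commute)
  finally show "\<exists>x\<in>convex hull V. \<exists>y\<in>convex hull V. steinhagen DIM('a) * inradius \<le> x \<bullet> u - y \<bullet> u"
    using x(1) y(1) by (meson hull_inc)
qed

text \<open>
  From \<open>t = inradius\<close> on, the inner parallel set has at most one point, whose \<open>(n - 1)\<close>-dimensional measure
  vanishes because \<open>n \<ge> 2\<close>.
\<close>

lemma perimeter_inner_parallel_le:
  assumes dim: "DIM('a) \<ge> 2" and t: "0 \<le> t"
  shows "perimeter (inner_parallel (convex hull V) t)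
    \<le> ennreal (max 0 (1 - t / inradius) ^ (DIM('a) - 1)) * perimeter (convex hull V)"
proof (cases "t < inradius")
  case True
  have S: "compact (convex hull V)" "convex (convex hull V)"
    using finite_V by (simp_all add: finite_imp_compact_convex_hull)
  have "perimeter (inner_parallel (convex hull V) t)
      \<le> perimeter (homothety centroid (1 - t / inradius) ` (convex hull V))"
    using S t compact_convex_homothety(1)[OF S] inner_parallel_subset_homothety[OF t True]
    by (intro perimeter_mono convex_inner_parallel closed_inner_parallel compact_imp_closed)
      (auto intro: compact_imp_bounded)
  then show ?thesis using True inradius_pos by (simp add: perimeter_homothety)
next
  case False
  then have "inner_parallel (convex hull V) t \<subseteq> {centroid}"
    using inner_parallel_subset_centroid by simp
  then consider "inner_parallel (convex hull V) t = {}" | "inner_parallel (convex hull V) t = {centroid}"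
    by (auto simp: subset_singleton_iff)
  then have "perimeter (inner_parallel (convex hull V) t) \<le> perimeter {centroid}"
    by cases (auto intro: perimeter_mono)
  also have "\<dots> = 0"
    unfolding perimeter_def using dim by (simp add: frontier_def hausdorff_measure_singleton)
  finally show ?thesis by simp
qed

end

section \<open>Perimeter of inner parallel sets in terms of the width\<close>

theorem perimeter_inner_parallel_ge_width:
  fixes S :: "'a::euclidean_space set"
  assumes "DIM('a) \<ge> 2" and S: "compact S" "convex S" "interior S \<noteq> {}" and "0 \<le> t"
  shows "ennreal (max 0 (1 - steinhagen DIM('a) / width S * t) ^ (DIM('a) - 1)) * perimeter S
    \<le> perimeter (inner_parallel S t)"
proof -
  obtain x r where r: "0 < r" "cball x r \<subseteq> S" "width S \<le> steinhagen DIM('a) * r"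
    by (rule steinhagen_inequality[OF S])
  have "0 < width S"
    using width_ge_diameter_of_ball[OF compact_imp_bounded[OF S(1)] r(2)] r(1) by linarith
  then have "1 / r \<le> steinhagen DIM('a) / width S"
    using r by (simp add: pos_divide_le_eq pos_le_divide_eq)
  then have "1 / r * t \<le> steinhagen DIM('a) / width S * t"
    using \<open>0 \<le> t\<close> by (rule mult_right_mono)
  then have "t / r \<le> steinhagen DIM('a) / width S * t" by simp
  then have "max 0 (1 - steinhagen DIM('a) / width S * t) ^ (DIM('a) - 1) \<le> max 0 (1 - t / r) ^ (DIM('a) - 1)"
    by (intro power_mono) auto
  then have "ennreal (max 0 (1 - steinhagen DIM('a) / width S * t) ^ (DIM('a) - 1)) * perimeter S
      \<le> ennreal (max 0 (1 - t / r) ^ (DIM('a) - 1)) * perimeter S"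
    by (intro mult_right_mono ennreal_leI) auto
  also have "\<dots> \<le> perimeter (inner_parallel S t)"
    using assms r by (intro perimeter_inner_parallel_ge) auto
  finally show ?thesis .
qed

text \<open>
  The bound of lemma \<open>perimeter_inner_parallel_le\<close> is at most the claimed value since
  \<open>steinhagen n / width S \<le> 1 / inradius\<close>; the general lower bound does the rest.
\<close>

theorem perimeter_inner_parallel_regular_simplex:
  fixes S :: "'a::euclidean_space set"
  assumes dim: "DIM('a) \<ge> 2" and S: "compact S" "convex S" "interior S \<noteq> {}" and t: "0 \<le> t"
    and "regular_simplex S"
  shows "perimeter (inner_parallel S t)
    = ennreal (max 0 (1 - steinhagen DIM('a) / width S * t) ^ (DIM('a) - 1)) * perimeter S"
proof (rule antisym)
  obtain V d where V: "card V = DIM('a) + 1" "\<not> affine_dependent V"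
      "\<forall>x\<in>V. \<forall>y\<in>V. x \<noteq> y \<longrightarrow> dist x y = d"
    and SV: "S = convex hull V"
    using \<open>regular_simplex S\<close> unfolding regular_simplex_def by (elim exE conjE)
  interpret regular_simplex_vertices V d
    by unfold_locales (use V in auto)
  have "0 < steinhagen DIM('a) * inradius" using steinhagen_pos inradius_pos by simp
  then have "0 < width S" using steinhagen_le_width by (simp add: SV)
  then have "steinhagen DIM('a) / width S \<le> 1 / inradius"
    using steinhagen_le_width inradius_pos by (simp add: SV pos_divide_le_eq pos_le_divide_eq)
  then have "steinhagen DIM('a) / width S * t \<le> 1 / inradius * t"
    using t by (rule mult_right_mono)
  then have "steinhagen DIM('a) / width S * t \<le> t / inradius" by simp
  then have "max 0 (1 - t / inradius) ^ (DIM('a) - 1) \<le> max 0 (1 - steinhagen DIM('a) / width S * t) ^ (DIM('a) - 1)"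
    by (intro power_mono) auto
  then have "ennreal (max 0 (1 - t / inradius) ^ (DIM('a) - 1)) * perimeter S
      \<le> ennreal (max 0 (1 - steinhagen DIM('a) / width S * t) ^ (DIM('a) - 1)) * perimeter S"
    by (intro mult_right_mono ennreal_leI) auto
  then show "perimeter (inner_parallel S t)
      \<le> ennreal (max 0 (1 - steinhagen DIM('a) / width S * t) ^ (DIM('a) - 1)) * perimeter S"
    using perimeter_inner_parallel_le[OF dim t] unfolding SV by (rule order_trans[rotated])
qed (rule perimeter_inner_parallel_ge_width[OF dim S t])

theorem corollary1p3:
  fixes \<Omega> :: "'a::euclidean_space set" and t :: real
  assumes "DIM('a) \<ge> 2"
    and "compact \<Omega>" and "convex \<Omega>" and "interior \<Omega> \<noteq> {}"
    and "t \<ge> 0"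
  shows "(odd DIM('a) \<longrightarrow>
            perimeter (inner_parallel \<Omega> t) \<ge>
              ennreal (max 0 (1 - 2 * sqrt (real DIM('a)) / width \<Omega> * t) ^ (DIM('a) - 1))
                * perimeter \<Omega>)
       \<and> (even DIM('a) \<longrightarrow>
            perimeter (inner_parallel \<Omega> t) \<ge>
              ennreal (max 0 (1 - 2 * (real DIM('a) + 1) / (width \<Omega> * sqrt (real DIM('a) + 2)) * t)
                         ^ (DIM('a) - 1))
                * perimeter \<Omega>)
       \<and> (regular_simplex \<Omega> \<longrightarrow>
            (odd DIM('a) \<longrightarrow>
               perimeter (inner_parallel \<Omega> t) =
                 ennreal (max 0 (1 - 2 * sqrt (real DIM('a)) / width \<Omega> * t) ^ (DIM('a) - 1))
                   * perimeter \<Omega>)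
          \<and> (even DIM('a) \<longrightarrow>
               perimeter (inner_parallel \<Omega> t) =
                 ennreal (max 0 (1 - 2 * (real DIM('a) + 1) / (width \<Omega> * sqrt (real DIM('a) + 2)) * t)
                            ^ (DIM('a) - 1))
                   * perimeter \<Omega>))"
proof -
  have odd: "2 * sqrt (real DIM('a)) / width \<Omega> = steinhagen DIM('a) / width \<Omega>" if "odd DIM('a)"
    using that by (simp add: steinhagen_odd)
  have even: "2 * (real DIM('a) + 1) / (width \<Omega> * sqrt (real DIM('a) + 2)) = steinhagen DIM('a) / width \<Omega>"
    if "even DIM('a)"
    using steinhagen_even[OF that] by (simp add: mult.commute)
  show ?thesis
  proof (cases "odd DIM('a)")
    case True
    then show ?thesis
      unfolding odd[OF True]
      using perimeter_inner_parallel_ge_width[OF assms] perimeter_inner_parallel_regular_simplex[OF assms]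
      by blast
  next
    case False
    then have "even DIM('a)" by simp
    then show ?thesis
      unfolding even[OF \<open>even DIM('a)\<close>]
      using perimeter_inner_parallel_ge_width[OF assms] perimeter_inner_parallel_regular_simplex[OF assms]
      by blast
  qed
qed

end
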